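(* Let $(X_n)_{n\ge0}$ be the two-armed bandit algorithm with parameters $p_A,p_B\in[0,1]$, $p_A\ne p_B$, and step sequence $(\gamma_n)_{n\ge1}$ (defined in the context). Let $X_\infty$ be the a.s. limit of $X_n$ and let $x_\infty=\mathbf 1_{\{p_A>p_B\}}$ (equal to $1$ if $p_A>p_B$ and $0$ otherwise). Then, for every $x\in(0,1)$ and every $n\ge1$, $\mathbb{P}_x$-a.s., $$\mathbb{P}_x(X_\infty\ne x_\infty\mid\mathcal F_n)\le\max\left(\min\left(\frac{1-X_n}{X_n},\frac{\sum_{k\ge n}\gamma_{k+1}^2}{X_n}\right),\ \min\left(\frac{X_n}{1-X_n},\frac{\sum_{k\ge n}\gamma_{k+1}^2}{1-X_n}\right)\right).$$
   Context: Two-armed bandit algorithm: let $(U_n)_{n\ge1}$ be i.i.d. random variables uniformly distributed on $[0,1]$, and let $(A_n)_{n\ge1},(B_n)_{n\ge1}$ be events such that $(\mathbf 1_{A_n},\mathbf 1_{B_n})_{n\ge1}$ is an i.i.d. sequence, independent of $(U_n)_{n\ge1}$, with $\mathbb{P}(A_1)=p_A$ and $\mathbb{P}(B_1)=p_B$. The steps satisfy $\gamma_n\in(0,1)$ for all $n\ge1$ and $\sum_n\gamma_n=+\infty$. The algorithm starting from $x\in[0,1]$ is defined by $X_0=x$ and, for $n\ge0$, $$X_{n+1}=X_n+\gamma_{n+1}\big((1-X_n)\mathbf 1_{\{U_{n+1}\le X_n\}\cap A_{n+1}}-X_n\mathbf 1_{\{U_{n+1}>X_n\}\cap B_{n+1}}\big).$$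 $\mathbb{P}_x$ denotes probability when $X_0=x$, and $\mathcal F_n=\sigma(U_k,\mathbf 1_{A_k},\mathbf 1_{B_k};\,1\le k\le n)$. The a.s. limit $X_\infty$ exists since $(X_n)$ is a $[0,1]$-valued sub- or supermartingale. If $x\in(0,1)$ then $X_n\in(0,1)$ for all $n$. The sum $\sum_{k\ge n}\gamma_{k+1}^2$ may be $+\infty$. *)

theory Defs
  imports "HOL-Probability.Probability"
begin

(* All sequences are indexed from 1; the values U 0, A 0, B 0 and gamma 0 are never used. *)

definition arm_indicators :: "(nat \<Rightarrow> 'a set) \<Rightarrow> (nat \<Rightarrow> 'a set) \<Rightarrow> nat \<Rightarrow> 'a \<Rightarrow> real \<times> real" where
  "arm_indicators A B n \<omega> = (indicator (A n) \<omega>, indicator (B n) \<omega>)"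

(* A n and B n with the same index may depend on each other: only the pairs of indicators
   are i.i.d. in n, and the whole sequence of pairs is independent of the whole sequence U.
   The latter is stated for the generated sigma-algebras because indep_var requires both
   variables to have the same value type. *)
locale two_armed_bandit = prob_space M
  for M :: "'a measure" +
  fixes U :: "nat \<Rightarrow> 'a \<Rightarrow> real"
    and A B :: "nat \<Rightarrow> 'a set"
    and pA pB :: real
    and \<gamma> :: "nat \<Rightarrow> real"
  assumes U_indep: "indep_vars (\<lambda>_. borel) U {1..}"
    and U_uniform: "\<And>n. n \<ge> 1 \<Longrightarrow> distr M borel (U n) = uniform_measure lborel {0..1}"
    and A_events: "\<And>n. n \<ge> 1 \<Longrightarrow> A n \<in> events"
    and B_events: "\<And>n. n \<ge> 1 \<Longrightarrow> B n \<in> events"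
    and arms_indep: "indep_vars (\<lambda>_. borel) (arm_indicators A B) {1..}"
    and arms_identical: "\<And>n. n \<ge> 1 \<Longrightarrow>
      distr M borel (arm_indicators A B n) = distr M borel (arm_indicators A B 1)"
    and U_arms_indep:
      "indep_set
         (sets (vimage_algebra (space M) (\<lambda>\<omega>. \<lambda>n\<in>{1..}. U n \<omega>) (PiM {1..} (\<lambda>_. borel))))
         (sets (vimage_algebra (space M) (\<lambda>\<omega>. \<lambda>n\<in>{1..}. arm_indicators A B n \<omega>)
            (PiM {1..} (\<lambda>_. borel))))"
    and prob_A: "prob (A 1) = pA"
    and prob_B: "prob (B 1) = pB"
    and step_range: "\<And>n. n \<ge> 1 \<Longrightarrow> \<gamma> n \<in> {0<..<1}"
    and step_sum: "(\<Sum>n. ereal (\<gamma> (Suc n))) = \<infinity>"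

primrec bandit ::
  "(nat \<Rightarrow> 'a \<Rightarrow> real) \<Rightarrow> (nat \<Rightarrow> 'a set) \<Rightarrow> (nat \<Rightarrow> 'a set) \<Rightarrow> (nat \<Rightarrow> real)
     \<Rightarrow> real \<Rightarrow> nat \<Rightarrow> 'a \<Rightarrow> real" where
  "bandit U A B \<gamma> x 0 = (\<lambda>\<omega>. x)"
| "bandit U A B \<gamma> x (Suc n) = (\<lambda>\<omega>.
     bandit U A B \<gamma> x n \<omega> + \<gamma> (Suc n) *
       ((1 - bandit U A B \<gamma> x n \<omega>) *
          indicator ({\<omega>'. U (Suc n) \<omega>' \<le> bandit U A B \<gamma> x n \<omega>'} \<inter> A (Suc n)) \<omega>
        - bandit U A B \<gamma> x n \<omega> *
          indicator ({\<omega>'. U (Suc n) \<omega>' > bandit U A B \<gamma> x n \<omega>'} \<inter> B (Suc n)) \<omega>))"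

(* The paths converge almost surely; lim is unspecified only on the null set of paths that do not. *)
definition bandit_limit ::
  "(nat \<Rightarrow> 'a \<Rightarrow> real) \<Rightarrow> (nat \<Rightarrow> 'a set) \<Rightarrow> (nat \<Rightarrow> 'a set) \<Rightarrow> (nat \<Rightarrow> real)
     \<Rightarrow> real \<Rightarrow> 'a \<Rightarrow> real" where
  "bandit_limit U A B \<gamma> x \<omega> = lim (\<lambda>n. bandit U A B \<gamma> x n \<omega>)"

definition bandit_filtration ::
  "'a measure \<Rightarrow> (nat \<Rightarrow> 'a \<Rightarrow> real) \<Rightarrow> (nat \<Rightarrow> 'a set) \<Rightarrow> (nat \<Rightarrow> 'a set) \<Rightarrow> nat \<Rightarrow> 'a measure" where
  "bandit_filtration M U A B n = sigma (space M)
     {f -` S \<inter> space M | f S. S \<in> sets (borel :: real measure) \<and>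
        f \<in> (\<Union>k\<in>{1..n}. {U k, indicator (A k), indicator (B k)})}"

definition cond_prob_subalg :: "'a measure \<Rightarrow> 'a measure \<Rightarrow> ('a \<Rightarrow> bool) \<Rightarrow> 'a \<Rightarrow> real" where
  "cond_prob_subalg M F P = real_cond_exp M F (indicator {\<omega> \<in> space M. P \<omega>})"

end

theory Submission
  imports Defs
begin

text \<open>
  Let \<open>p\<^sub>A > p\<^sub>B\<close>; the other case follows by passing to \<open>1 - X\<close> and exchanging the arms.
  If \<open>T\<^sub>n = (\<Sum>k\<ge>n. \<gamma>\<^sub>k\<^sub>+\<^sub>1\<^sup>2)\<close> is infinite, the right-hand side is at least 1. Otherwise, for every
  \<open>e > 0\<close>, the process \<open>min 1 ((T\<^sub>n + e) / X\<^sub>n)\<close> is a supermartingale, and it eventually equals 1 on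
  paths with \<open>X\<^sub>n \<longlonglongrightarrow> 0\<close>; hence \<open>P (X\<^sub>n \<longlonglongrightarrow> 0 | F\<^sub>n) \<le> (T\<^sub>n + e) / X\<^sub>n\<close>, and one lets \<open>e\<close> tend
  to 0. The parameter \<open>e\<close> is essential: \<open>T\<^sub>n / X\<^sub>n\<close> alone could vanish in the limit. Almost surely
  \<open>X\<^sub>n\<close> tends to 0 or 1: its martingale part converges by a maximal inequality, as \<open>T\<^sub>0\<close> is finite,
  and its drift \<open>(p\<^sub>A - p\<^sub>B) * (\<Sum>k. \<gamma>\<^sub>k\<^sub>+\<^sub>1 * X\<^sub>k * (1 - X\<^sub>k))\<close> has finite expectation, while the
  steps are not summable. Finally \<open>min 1 (T / X)\<close> is at most the stated bound, because one of
  \<open>X / (1 - X)\<close> and \<open>(1 - X) / X\<close> is at least 1.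
\<close>

section \<open>Supermartingale estimates\<close>

text \<open>Drift of \<open>s / y\<close> when \<open>y\<close> jumps to
  \<open>y + t * (1 - y)\<close> with probability \<open>p * y\<close> and to
  \<open>(1 - t) * y\<close> with probability \<open>q * (1 - y)\<close>. An upward jump lowers the
  ratio, so \<open>p\<close> may be replaced by \<open>q\<close>. The first-order terms in
  \<open>t\<close> then cancel, and what remains is \<open>t^2 / y\<close> times a factor that
  \<open>s + t^2 \<le> y\<close> keeps below 1.\<close>

lemma reciprocal_drift_le:
  fixes s t y p q :: real
  assumes "0 < y" "y < 1" "0 < t" "t < 1" "0 \<le> q" "q \<le> p" "q \<le> 1" "0 \<le> s" "s + t\<^sup>2 \<le> y"
  shows "s / y + p * y * (s / (y + t * (1 - y)) - s / y)
           + q * (1 - y) * (s / ((1 - t) * y) - s / y) \<le> (s + t\<^sup>2) / y"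
proof -
  define a where "a = y + t * (1 - y)"
  have a: "a > 0" "a \<ge> y" using assms by (auto simp: a_def intro!: add_pos_nonneg)
  have up: "y * (s / a - s / y) = - (s * t * (1 - y) / a)"
  proof -
    have "y * (s / a - s / y) = s * (y - a) / a"
      using a assms by (simp add: field_simps)
    also have "y - a = - (t * (1 - y))" by (simp add: a_def)
    finally show ?thesis by simp
  qed
  have dn: "s / ((1 - t) * y) - s / y = s * t / ((1 - t) * y)"
    using assms by (simp add: field_simps)
  \<comment> \<open>The gap between \<open>(1 - t) * a\<close> and
    \<open>(y - t^2) * (1 - y)\<close> is exactly \<open>(y - t)^2 + t * (1 - t)\<close>, which is
    nonnegative.\<close>
  have "s * (1 - y) \<le> (y - t\<^sup>2) * (1 - y)"
    using assms by (intro mult_right_mono) auto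
  also have "\<dots> = (1 - t) * a - ((y - t)\<^sup>2 + t * (1 - t))"
    by (simp add: a_def power2_eq_square algebra_simps)
  also have "\<dots> \<le> (1 - t) * a"
    using assms zero_le_power2[of "y - t"] mult_nonneg_nonneg[of t "1 - t"] by linarith
  finally have key: "s * (1 - y) \<le> (1 - t) * a" .
  have "q * (s * (1 - y)) \<le> 1 * (s * (1 - y))"
    using assms by (intro mult_right_mono) auto
  with key have "q * (s * (1 - y)) \<le> (1 - t) * a" by linarith
  hence *: "q * (s * (1 - y)) / ((1 - t) * a) \<le> 1" using assms a by simp
  have "p * y * (s / a - s / y) = - (p * (s * t * (1 - y) / a))"
    using up by (simp add: mult.assoc)
  also have "\<dots> \<le> - (q * (s * t * (1 - y) / a))"
    using assms a by (intro le_imp_neg_le mult_right_mono) auto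
  finally have "p * y * (s / a - s / y) + q * (1 - y) * (s / ((1 - t) * y) - s / y)
      \<le> q * (s * t * (1 - y)) * (1 / ((1 - t) * y) - 1 / a)"
  proof -
    have "q * (1 - y) * (s * t / ((1 - t) * y)) = q * (s * t * (1 - y)) * (1 / ((1 - t) * y))"
      "q * (s * t * (1 - y) / a) = q * (s * t * (1 - y)) * (1 / a)"
      by simp_all
    thus ?thesis if "p * y * (s / a - s / y) \<le> - (q * (s * t * (1 - y) / a))"
      using that unfolding dn right_diff_distrib[of _ "1 / ((1 - t) * y)"] by linarith
  qed
  also have "1 / ((1 - t) * y) - 1 / a = t / ((1 - t) * y * a)"
    using assms a by (simp add: field_simps) (simp add: a_def algebra_simps)
  also have "q * (s * t * (1 - y)) * (t / ((1 - t) * y * a))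
      = (t\<^sup>2 / y) * (q * (s * (1 - y)) / ((1 - t) * a))"
    by (simp add: power2_eq_square mult_ac)
  also have "\<dots> \<le> (t\<^sup>2 / y) * 1" using * assms by (intro mult_left_mono) auto
  finally show ?thesis by (simp add: a_def add_divide_distrib)
qed

lemma suminf_tail_Suc:
  fixes f :: "nat \<Rightarrow> real"
  assumes "summable f"
  shows "(\<Sum>j. f (j + k)) = f k + (\<Sum>j. f (j + Suc k))"
  using suminf_split_head[of "\<lambda>j. f (j + k)"] assms by simp

text \<open>The maximal inequality over a finite horizon. The supermartingale property is taken in
  integrated form over the events of \<open>F j\<close>, the form in which the drift estimates
  deliver it.\<close>

lemma (in prob_space) nonneg_supermartingale_maximal:
  fixes V :: "nat \<Rightarrow> 'a \<Rightarrow> real" and F :: "nat \<Rightarrow> 'a measure"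
  assumes sub: "\<And>j. subalgebra M (F j)"
    and mono: "\<And>i j. i \<le> j \<Longrightarrow> sets (F i) \<subseteq> sets (F j)"
    and meas: "\<And>j. V j \<in> borel_measurable (F j)"
    and int: "\<And>j. integrable M (V j)"
    and nonneg: "\<And>j \<omega>. k \<le> j \<Longrightarrow> 0 \<le> V j \<omega>"
    and step: "\<And>j D. k \<le> j \<Longrightarrow> D \<in> sets (F j) \<Longrightarrow>
       expectation (\<lambda>\<omega>. indicator D \<omega> * V (Suc j) \<omega>) \<le> expectation (\<lambda>\<omega>. indicator D \<omega> * V j \<omega>)"
  shows "c * prob {\<omega>\<in>space M. \<exists>j\<in>{k..k + m}. c \<le> V j \<omega>} \<le> expectation (V k)"
proof -
  define H where "H m = {\<omega>\<in>space M. \<exists>j\<in>{k..k + m}. c \<le> V j \<omega>}" for m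
  have space_F: "space (F j) = space M" for j using sub by (simp add: subalgebra_def)
  have setsM: "sets (F j) \<subseteq> sets M" for j using sub by (simp add: subalgebra_def)
  have V_F: "{\<omega>\<in>space M. c \<le> V j \<omega>} \<in> sets (F i)" if "j \<le> i" for i j
    using meas[of j] mono[OF that] by (auto simp: space_F[symmetric, of j])
  have HF: "H m \<in> sets (F (k + m))" for m
  proof -
    have "H m = (\<Union>j\<in>{k..k+m}. {\<omega>\<in>space M. c \<le> V j \<omega>})" by (auto simp: H_def)
    thus ?thesis using V_F by auto
  qed
  have HM: "H m \<in> sets M" for m using HF setsM by blast
  have [measurable]: "V j \<in> borel_measurable M" for j using int by auto
  define G where "G m = space M - H m" for m
  have GF: "G m \<in> sets (F (k + m))" for m
    using sets.compl_sets[OF HF] by (simp add: G_def space_F)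
  have GM: "G m \<in> sets M" for m using GF setsM by blast
  have intG: "integrable M (\<lambda>\<omega>. indicator D \<omega> * V j \<omega>)" if "D \<in> sets M" for D j
    using integrable_mult_indicator[OF that int[of j]] by simp
  have split: "c * prob D + expectation (\<lambda>\<omega>. indicator E \<omega> * V j \<omega>)
      = expectation (\<lambda>\<omega>. c * indicator D \<omega> + indicator E \<omega> * V j \<omega>)"
    and int_split: "integrable M (\<lambda>\<omega>. c * indicator D \<omega> + indicator E \<omega> * V j \<omega>)"
    if D: "D \<in> sets M" and E: "E \<in> sets M" for D E j
  proof -
    have *: "integrable M (\<lambda>\<omega>. c * indicator D \<omega> :: real)"
      using D by (auto simp: less_top[symmetric])
    have "expectation (\<lambda>\<omega>. c * indicator D \<omega> :: real) = c * prob D"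
      using D sets.sets_into_space[OF D] by (simp add: Int_absorb2)
    with * show "c * prob D + expectation (\<lambda>\<omega>. indicator E \<omega> * V j \<omega>)
      = expectation (\<lambda>\<omega>. c * indicator D \<omega> + indicator E \<omega> * V j \<omega>)"
      using intG[OF E] by (subst Bochner_Integration.integral_add) auto
    show "integrable M (\<lambda>\<omega>. c * indicator D \<omega> + indicator E \<omega> * V j \<omega>)"
      using * intG[OF E] by auto
  qed
  \<comment> \<open>The left-hand side is the mean of the process that follows \<open>V\<close> and
    is frozen at the value \<open>c\<close> once level \<open>c\<close> has been reached; it does
    not increase with \<open>m\<close>.\<close>
  have "c * prob (H m) + expectation (\<lambda>\<omega>. indicator (G m) \<omega> * V (k + m) \<omega>) \<le> expectation (V k)"
  proof (induction m)
    case 0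
    have "c * prob (H 0) + expectation (\<lambda>\<omega>. indicator (G 0) \<omega> * V k \<omega>)
        = expectation (\<lambda>\<omega>. c * indicator (H 0) \<omega> + indicator (G 0) \<omega> * V k \<omega>)"
      using split[OF HM GM, of 0 0 k] by simp
    also have "\<dots> \<le> expectation (V k)"
      by (intro integral_mono int_split HM GM int)
        (auto simp: H_def G_def indicator_def)
    finally show ?case by simp
  next
    case (Suc m)
    have "c * prob (H (Suc m)) + expectation (\<lambda>\<omega>. indicator (G (Suc m)) \<omega> * V (k + Suc m) \<omega>)
        = expectation (\<lambda>\<omega>. c * indicator (H (Suc m)) \<omega> + indicator (G (Suc m)) \<omega> * V (k + Suc m) \<omega>)"
      by (rule split[OF HM GM])
    \<comment> \<open>A path that first reaches the level at time \<open>k + Suc m\<close> has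
      \<open>V\<close> at least \<open>c\<close> there, so restoring \<open>V\<close> in place of
      \<open>c\<close> can only increase the integrand.\<close>
    also have "\<dots> \<le> expectation (\<lambda>\<omega>. c * indicator (H m) \<omega> + indicator (G m) \<omega> * V (k + Suc m) \<omega>)"
    proof (intro integral_mono int_split HM GM int)
      fix \<omega> assume w: "\<omega> \<in> space M"
      have "H (Suc m) = H m \<union> {\<omega>\<in>space M. c \<le> V (k + Suc m) \<omega>}"
        by (auto simp: H_def le_Suc_eq)
      with w nonneg[of "k + Suc m" \<omega>]
      show "c * indicator (H (Suc m)) \<omega> + indicator (G (Suc m)) \<omega> * V (k + Suc m) \<omega>
        \<le> c * indicator (H m) \<omega> + indicator (G m) \<omega> * V (k + Suc m) \<omega>"
        by (auto simp: G_def indicator_def)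
    qed
    also have "\<dots> = c * prob (H m) + expectation (\<lambda>\<omega>. indicator (G m) \<omega> * V (Suc (k + m)) \<omega>)"
      by (simp add: split[OF HM GM])
    also have "\<dots> \<le> c * prob (H m) + expectation (\<lambda>\<omega>. indicator (G m) \<omega> * V (k + m) \<omega>)"
      using step[OF _ GF, of m] by simp
    also have "\<dots> \<le> expectation (V k)" by (rule Suc)
    finally show ?case .
  qed
  moreover have "0 \<le> expectation (\<lambda>\<omega>. indicator (G m) \<omega> * V (k + m) \<omega>)"
    using nonneg by (intro Bochner_Integration.integral_nonneg mult_nonneg_nonneg) auto
  ultimately show ?thesis by (simp add: H_def)
qed

section \<open>Walks with state-dependent steps up and down\<close>

text \<open>The parameters are symmetric under replacing \<open>X\<close> by \<open>1 - X\<close> and exchanging \<open>Up\<close> with \<open>Dn\<close>;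
  the step from time \<open>k\<close> to \<open>k + 1\<close> carries the index \<open>k\<close>.\<close>
locale reinforced_walk = prob_space M
  for M :: "'a measure" +
  fixes F :: "nat \<Rightarrow> 'a measure"
    and X :: "nat \<Rightarrow> 'a \<Rightarrow> real"
    and Up Dn :: "nat \<Rightarrow> 'a set"
    and g :: "nat \<Rightarrow> real"
    and p q :: real
  assumes subalg: "\<And>k. subalgebra M (F k)"
    and sets_F_Suc: "\<And>k. sets (F k) \<subseteq> sets (F (Suc k))"
    and X_measurable_F: "\<And>k. X k \<in> borel_measurable (F k)"
    and X_bounds: "\<And>k \<omega>. 0 < X k \<omega> \<and> X k \<omega> < 1"
    and Up_event: "\<And>k. Up k \<in> events"
    and Dn_event: "\<And>k. Dn k \<in> events"
    and Up_Dn_disjoint: "\<And>k. Up k \<inter> Dn k = {}"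
    and X_Suc: "\<And>k \<omega>. X (Suc k) \<omega> =
       X k \<omega> + g k * ((1 - X k \<omega>) * indicator (Up k) \<omega> - X k \<omega> * indicator (Dn k) \<omega>)"
    and Up_prob: "\<And>k D. D \<in> sets (F k) \<Longrightarrow>
       prob (D \<inter> Up k) = expectation (\<lambda>\<omega>. indicator D \<omega> * (p * X k \<omega>))"
    and Dn_prob: "\<And>k D. D \<in> sets (F k) \<Longrightarrow>
       prob (D \<inter> Dn k) = expectation (\<lambda>\<omega>. indicator D \<omega> * (q * (1 - X k \<omega>)))"
    and g_bounds: "\<And>k. 0 < g k \<and> g k < 1"
    and summable_g2: "summable (\<lambda>k. (g k)\<^sup>2)"
    and not_summable_g: "\<not> summable g"
    and pq: "0 \<le> q" "q < p" "p \<le> 1"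
begin

section \<open>One-step expectations of the walk\<close>

lemma space_F: "space (F k) = space M"
  using subalg[of k] by (simp add: subalgebra_def)

lemma sets_F_subset: "sets (F k) \<subseteq> events"
  using subalg[of k] by (simp add: subalgebra_def)

lemma sets_F_mono: "i \<le> j \<Longrightarrow> sets (F i) \<subseteq> sets (F j)"
  by (rule lift_Suc_mono_le[of "\<lambda>k. sets (F k)"]) (use sets_F_Suc in auto)

lemma measurable_F_mono:
  fixes f :: "'a \<Rightarrow> real"
  assumes "f \<in> borel_measurable (F i)" "i \<le> j"
  shows "f \<in> borel_measurable (F j)"
proof (rule measurable_from_subalg[OF _ assms(1)])
  show "subalgebra (F j) (F i)"
    using sets_F_mono[OF assms(2)] by (simp add: subalgebra_def space_F)
qed

lemma X_measurable_le: "i \<le> j \<Longrightarrow> X i \<in> borel_measurable (F j)"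
  by (rule measurable_F_mono[OF X_measurable_F])

lemma measurable_F_M: "f \<in> borel_measurable (F k) \<Longrightarrow> f \<in> borel_measurable M"
  by (rule measurable_from_subalg[OF subalg])

lemma X_random [measurable]: "X k \<in> borel_measurable M"
  by (rule measurable_F_M[OF X_measurable_F])

lemma finite_measure_subalgebra_F: "finite_measure_subalgebra M (F k)"
  by unfold_locales (rule subalg)

text \<open>The hypothesis \<open>eq\<close> identifies \<open>h\<close> as the conditional
  probability of \<open>H\<close> given \<open>F k\<close>, so any bounded
  \<open>F k\<close>-measurable factor can be carried along. This extends \<open>Up_prob\<close> and
  \<open>Dn_prob\<close> from indicators to such factors.\<close>

lemma cond_prob_eq_imp_expectation_eq:
  fixes Z h :: "'a \<Rightarrow> real"
  assumes H: "H \<in> events"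
    and h: "h \<in> borel_measurable (F k)" "\<And>\<omega>. \<bar>h \<omega>\<bar> \<le> 1"
    and eq: "\<And>D. D \<in> sets (F k) \<Longrightarrow> prob (D \<inter> H) = expectation (\<lambda>\<omega>. indicator D \<omega> * h \<omega>)"
    and Z: "Z \<in> borel_measurable (F k)" "\<And>\<omega>. \<bar>Z \<omega>\<bar> \<le> C"
  shows "expectation (\<lambda>\<omega>. Z \<omega> * indicator H \<omega>) = expectation (\<lambda>\<omega>. Z \<omega> * h \<omega>)"
proof -
  interpret S: finite_measure_subalgebra M "F k" by (rule finite_measure_subalgebra_F)
  have [measurable]: "h \<in> borel_measurable M" "Z \<in> borel_measurable M"
    using h Z measurable_F_M by blast+
  note H[measurable]
  have inth: "integrable M h"
    by (rule integrable_const_bound[where B=1]) (use h in auto)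
  have intH: "integrable M (indicator H :: 'a \<Rightarrow> real)"
    using H by (auto simp: less_top[symmetric])
  have "AE \<omega> in M. real_cond_exp M (F k) (indicator H) \<omega> = h \<omega>"
  proof (rule S.real_cond_exp_charact)
    fix D assume D: "D \<in> sets (F k)"
    have "(\<integral>\<omega>\<in>D. indicator H \<omega> \<partial>M) = expectation (indicator (D \<inter> H) :: 'a \<Rightarrow> real)"
      unfolding set_lebesgue_integral_def
      by (intro Bochner_Integration.integral_cong) (auto simp: indicator_def)
    also have "\<dots> = prob (D \<inter> H)"
      using sets.sets_into_space[OF H] by (simp add: Int_absorb2 le_infI2)
    also have "\<dots> = (\<integral>\<omega>\<in>D. h \<omega> \<partial>M)"
      using eq[OF D] by (simp add: set_lebesgue_integral_def)
    finally show "(\<integral>\<omega>\<in>D. indicator H \<omega> \<partial>M) = (\<integral>\<omega>\<in>D. h \<omega> \<partial>M)" .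
  qed (use inth intH h in auto)
  hence "expectation (\<lambda>\<omega>. Z \<omega> * h \<omega>) = expectation (\<lambda>\<omega>. Z \<omega> * real_cond_exp M (F k) (indicator H) \<omega>)"
    by (intro integral_cong_AE) auto
  also have "\<dots> = expectation (\<lambda>\<omega>. Z \<omega> * indicator H \<omega>)"
  proof (rule S.real_cond_exp_intg(2)[OF _ Z(1)])
    show "integrable M (\<lambda>\<omega>. Z \<omega> * indicator H \<omega>)"
      by (rule integrable_const_bound[where B=C])
        (use Z(2) order_trans[OF abs_ge_zero Z(2)] in \<open>auto simp: indicator_def\<close>)
  qed auto
  finally show ?thesis ..
qed

lemma expectation_Up:
  assumes "Z \<in> borel_measurable (F k)" "\<And>\<omega>. \<bar>Z \<omega>\<bar> \<le> (C::real)"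
  shows "expectation (\<lambda>\<omega>. Z \<omega> * indicator (Up k) \<omega>) = expectation (\<lambda>\<omega>. Z \<omega> * (p * X k \<omega>))"
proof (rule cond_prob_eq_imp_expectation_eq[OF Up_event _ _ Up_prob assms])
  show "(\<lambda>\<omega>. p * X k \<omega>) \<in> borel_measurable (F k)" using X_measurable_F[of k] by simp
  show "\<bar>p * X k \<omega>\<bar> \<le> 1" for \<omega>
    using X_bounds[of k \<omega>] pq by (simp add: abs_mult mult_le_one)
qed

lemma expectation_Dn:
  assumes "Z \<in> borel_measurable (F k)" "\<And>\<omega>. \<bar>Z \<omega>\<bar> \<le> (C::real)"
  shows "expectation (\<lambda>\<omega>. Z \<omega> * indicator (Dn k) \<omega>) = expectation (\<lambda>\<omega>. Z \<omega> * (q * (1 - X k \<omega>)))"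
proof (rule cond_prob_eq_imp_expectation_eq[OF Dn_event _ _ Dn_prob assms])
  show "(\<lambda>\<omega>. q * (1 - X k \<omega>)) \<in> borel_measurable (F k)" using X_measurable_F[of k] by simp
  show "\<bar>q * (1 - X k \<omega>)\<bar> \<le> 1" for \<omega>
    using X_bounds[of k \<omega>] pq by (simp add: abs_mult mult_le_one)
qed

lemma integrable_bounded:
  assumes "f \<in> borel_measurable M" "\<And>\<omega>. \<bar>f \<omega>\<bar> \<le> (C::real)"
  shows "integrable M f"
  by (rule integrable_const_bound[where B=C]) (use assms in auto)

text \<open>All drift computations go through this identity: \<open>a\<close>, \<open>b\<close> and
  \<open>c\<close> are the values of a functional after no move, a move up and a move down, and all
  three are known at time \<open>k\<close>.\<close>

lemma expectation_step:
  fixes a b c :: "'a \<Rightarrow> real"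
  assumes a: "a \<in> borel_measurable (F k)" "\<And>\<omega>. \<bar>a \<omega>\<bar> \<le> C"
    and b: "b \<in> borel_measurable (F k)" "\<And>\<omega>. \<bar>b \<omega>\<bar> \<le> C"
    and c: "c \<in> borel_measurable (F k)" "\<And>\<omega>. \<bar>c \<omega>\<bar> \<le> C"
  shows "expectation (\<lambda>\<omega>. if \<omega> \<in> Up k then b \<omega> else if \<omega> \<in> Dn k then c \<omega> else a \<omega>)
    = expectation (\<lambda>\<omega>. a \<omega> + p * X k \<omega> * (b \<omega> - a \<omega>) + q * (1 - X k \<omega>) * (c \<omega> - a \<omega>))"
proof -
  note Up_event[measurable] Dn_event[measurable]
  note [measurable] = a(1)[THEN measurable_F_M] b(1)[THEN measurable_F_M] c(1)[THEN measurable_F_M]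
  have ba: "\<bar>b \<omega> - a \<omega>\<bar> \<le> 2 * C" "\<bar>c \<omega> - a \<omega>\<bar> \<le> 2 * C" for \<omega>
    using a(2)[of \<omega>] b(2)[of \<omega>] c(2)[of \<omega>] by linarith+
  \<comment> \<open>\<open>undefined\<close> merely supplies some point at which to read off the
    bound.\<close>
  have C: "0 \<le> C" using a(2)[of undefined] by linarith
  have i1: "integrable M a" using a by (intro integrable_bounded) auto
  have i2: "integrable M (\<lambda>\<omega>. (b \<omega> - a \<omega>) * indicator (Up k) \<omega>)"
      "integrable M (\<lambda>\<omega>. (c \<omega> - a \<omega>) * indicator (Dn k) \<omega>)"
    using ba C by (auto intro!: integrable_bounded[where C="2 * C"] simp: indicator_def)
  have i3: "integrable M (\<lambda>\<omega>. (b \<omega> - a \<omega>) * (p * X k \<omega>))"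
      "integrable M (\<lambda>\<omega>. (c \<omega> - a \<omega>) * (q * (1 - X k \<omega>)))"
  proof -
    have "\<bar>(b \<omega> - a \<omega>) * (p * X k \<omega>)\<bar> \<le> 2 * C * 1" for \<omega>
      unfolding abs_mult[of "b \<omega> - a \<omega>"]
      using X_bounds[of k \<omega>] pq C by (intro mult_mono ba) (auto simp: abs_mult mult_le_one)
    moreover have "\<bar>(c \<omega> - a \<omega>) * (q * (1 - X k \<omega>))\<bar> \<le> 2 * C * 1" for \<omega>
      unfolding abs_mult[of "c \<omega> - a \<omega>"]
      using X_bounds[of k \<omega>] pq C by (intro mult_mono ba) (auto simp: abs_mult mult_le_one)
    ultimately show "integrable M (\<lambda>\<omega>. (b \<omega> - a \<omega>) * (p * X k \<omega>))"
      "integrable M (\<lambda>\<omega>. (c \<omega> - a \<omega>) * (q * (1 - X k \<omega>)))"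
      by (auto intro!: integrable_bounded[where C="2 * C"])
  qed
  have "expectation (\<lambda>\<omega>. if \<omega> \<in> Up k then b \<omega> else if \<omega> \<in> Dn k then c \<omega> else a \<omega>)
    = expectation (\<lambda>\<omega>. a \<omega> + (b \<omega> - a \<omega>) * indicator (Up k) \<omega> + (c \<omega> - a \<omega>) * indicator (Dn k) \<omega>)"
    using Up_Dn_disjoint[of k] by (intro Bochner_Integration.integral_cong) (auto simp: indicator_def)
  also have "\<dots> = expectation a + expectation (\<lambda>\<omega>. (b \<omega> - a \<omega>) * indicator (Up k) \<omega>)
      + expectation (\<lambda>\<omega>. (c \<omega> - a \<omega>) * indicator (Dn k) \<omega>)"
    using i1 i2 by simp
  also have "\<dots> = expectation a + expectation (\<lambda>\<omega>. (b \<omega> - a \<omega>) * (p * X k \<omega>))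
      + expectation (\<lambda>\<omega>. (c \<omega> - a \<omega>) * (q * (1 - X k \<omega>)))"
    using a b c ba by (simp add: expectation_Up[where C="2 * C"] expectation_Dn[where C="2 * C"])
  also have "\<dots> = expectation (\<lambda>\<omega>. a \<omega> + (b \<omega> - a \<omega>) * (p * X k \<omega>) + (c \<omega> - a \<omega>) * (q * (1 - X k \<omega>)))"
    using i1 i3 by simp
  finally show ?thesis by (simp add: mult_ac)
qed

section \<open>The capped ratio as a supermartingale\<close>

definition g2_tail :: "nat \<Rightarrow> real" where
  "g2_tail k = (\<Sum>j. (g (j + k))\<^sup>2)"

lemma g2_tail_Suc: "g2_tail k = (g k)\<^sup>2 + g2_tail (Suc k)"
  unfolding g2_tail_def by (rule suminf_tail_Suc[OF summable_g2])

lemma g2_tail_nonneg: "0 \<le> g2_tail k"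
  unfolding g2_tail_def
  by (intro suminf_nonneg summable_ignore_initial_segment summable_g2) auto

lemma g2_tail_tendsto: "g2_tail \<longlonglongrightarrow> 0"
  unfolding g2_tail_def by (rule suminf_exist_split2[OF summable_g2])

text \<open>The cap keeps the process bounded, and it confines the use of
  \<open>reciprocal_drift_le\<close> to the region where \<open>X\<close> is at least the numerator,
  as that estimate requires.\<close>

definition capped_ratio :: "real \<Rightarrow> nat \<Rightarrow> 'a \<Rightarrow> real" where
  "capped_ratio e k \<omega> = min 1 ((g2_tail k + e) / X k \<omega>)"

lemma capped_ratio_bounds:
  assumes "0 < e" shows "0 \<le> capped_ratio e k \<omega>" "capped_ratio e k \<omega> \<le> 1"
  using assms g2_tail_nonneg[of k] X_bounds[of k \<omega>] by (auto simp: capped_ratio_def)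

lemma capped_ratio_measurable_F: "capped_ratio e k \<in> borel_measurable (F k)"
  unfolding capped_ratio_def[abs_def] using X_measurable_F[of k] by simp

text \<open>Where the cap is inactive at time \<open>k\<close>, \<open>reciprocal_drift_le\<close>
  applies with \<open>t = g k\<close>: the increase by \<open>t^2\<close> of the numerator is
  precisely the term that the tail loses from \<open>k\<close> to \<open>Suc k\<close>. Where the
  cap is active the process already has its largest value 1.\<close>

lemma capped_ratio_supermartingale_Suc:
  assumes e: "0 < e" and D: "D \<in> sets (F k)"
  shows "expectation (\<lambda>\<omega>. indicator D \<omega> * capped_ratio e (Suc k) \<omega>)
    \<le> expectation (\<lambda>\<omega>. indicator D \<omega> * capped_ratio e k \<omega>)"
proof -
  define s where "s = g2_tail (Suc k) + e"
  define t where "t = g k"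
  have s0: "0 < s" using e g2_tail_nonneg[of "Suc k"] by (simp add: s_def)
  have t: "0 < t" "t < 1" using g_bounds by (auto simp: t_def)
  have S: "g2_tail k + e = s + t\<^sup>2" by (simp add: s_def t_def g2_tail_Suc[of k])
  \<comment> \<open>The region where the cap is inactive at time \<open>k\<close>.\<close>
  define L where "L = {\<omega>\<in>space M. s + t\<^sup>2 \<le> X k \<omega>}"
  have L: "L \<in> sets (F k)" unfolding L_def space_F[of k, symmetric]
    using X_measurable_F[of k] by simp
  define E where "E = D \<inter> L"
  have E: "E \<in> sets (F k)" and DL: "D - L \<in> sets (F k)" using D L by (auto simp: E_def)
  have EM: "E \<in> events" and DLM: "D - L \<in> events" and DM: "D \<in> events"
    using E DL D sets_F_subset by auto
  note [measurable] = EM DLM DM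
  \<comment> \<open>On \<open>E\<close> the ratio \<open>s / X k\<close> is at most 1, a move up
    lowers it, and a move down divides it by \<open>1 - t\<close>; hence \<open>C\<close> bounds all
    three outcomes.\<close>
  define C where "C = 1 / (1 - t)"
  have C: "1 \<le> C" using t by (simp add: C_def)
  \<comment> \<open>Uncapped ratios at time \<open>Suc k\<close> after no move, a move up and a move
    down, cut off outside \<open>E\<close> to stay bounded.\<close>
  define a where "a \<omega> = indicator E \<omega> * (s / X k \<omega>)" for \<omega>
  define b where "b \<omega> = indicator E \<omega> * (s / (X k \<omega> + t * (1 - X k \<omega>)))" for \<omega>
  define c where "c \<omega> = indicator E \<omega> * (s / ((1 - t) * X k \<omega>))" for \<omega>
  have meas: "a \<in> borel_measurable (F k)" "b \<in> borel_measurable (F k)" "c \<in> borel_measurable (F k)"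
    unfolding a_def[abs_def] b_def[abs_def] c_def[abs_def]
    using E X_measurable_F[of k] by measurable
  note measM[measurable] = meas[THEN measurable_F_M]
  have bd: "0 \<le> a \<omega> \<and> a \<omega> \<le> C" "0 \<le> b \<omega> \<and> b \<omega> \<le> C" "0 \<le> c \<omega> \<and> c \<omega> \<le> C" for \<omega>
  proof -
    have "0 \<le> s / X k \<omega>" using s0 X_bounds[of k \<omega>] by simp
    moreover have ale: "s / X k \<omega> \<le> 1" if "\<omega> \<in> E"
    proof -
      have "s \<le> X k \<omega>" using that order_trans[of s "s + t\<^sup>2"] by (simp add: E_def L_def)
      thus ?thesis using X_bounds[of k \<omega>] by simp
    qed
    ultimately show "0 \<le> a \<omega> \<and> a \<omega> \<le> C" using C by (auto simp: a_def indicator_def)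
    have y: "X k \<omega> \<le> X k \<omega> + t * (1 - X k \<omega>)" using X_bounds[of k \<omega>] t by simp
    have "s / (X k \<omega> + t * (1 - X k \<omega>)) \<le> s / X k \<omega>"
      using y X_bounds[of k \<omega>] s0 by (intro divide_left_mono mult_pos_pos) linarith+
    moreover have "0 \<le> s / (X k \<omega> + t * (1 - X k \<omega>))"
      using y X_bounds[of k \<omega>] s0 by (intro divide_nonneg_nonneg) linarith+
    ultimately show "0 \<le> b \<omega> \<and> b \<omega> \<le> C" using C ale
      by (auto simp: b_def indicator_def)
    have ceq: "s / ((1 - t) * X k \<omega>) = C * (s / X k \<omega>)" by (simp add: C_def)
    have "C * (s / X k \<omega>) \<le> C * 1" if "\<omega> \<in> E" using ale[OF that] C by (intro mult_left_mono) auto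
    moreover have "0 \<le> C * (s / X k \<omega>)" using C \<open>0 \<le> s / X k \<omega>\<close> by (intro mult_nonneg_nonneg) auto
    ultimately show "0 \<le> c \<omega> \<and> c \<omega> \<le> C" using C
      unfolding c_def ceq by (auto simp: indicator_def simp del: times_divide_eq_right)
  qed
  have bda: "\<bar>a \<omega>\<bar> \<le> C" "\<bar>b \<omega>\<bar> \<le> C" "\<bar>c \<omega>\<bar> \<le> C" for \<omega>
    using bd[of \<omega>] by simp_all
  let ?f = "\<lambda>\<omega>. if \<omega> \<in> Up k then b \<omega> else if \<omega> \<in> Dn k then c \<omega> else a \<omega>"
  let ?h = "\<lambda>\<omega>. a \<omega> + p * X k \<omega> * (b \<omega> - a \<omega>) + q * (1 - X k \<omega>) * (c \<omega> - a \<omega>)"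
  note Up_event[measurable] Dn_event[measurable]
  have capm [measurable]: "capped_ratio e j \<in> borel_measurable M" for j
    by (rule measurable_F_M[OF capped_ratio_measurable_F])
  have intW: "integrable M (\<lambda>\<omega>. indicator D \<omega> * capped_ratio e j \<omega>)" for j
    by (rule integrable_bounded[where C=1])
      (use capped_ratio_bounds[OF e] in \<open>auto simp: indicator_def\<close>)
  have intI: "integrable M (indicator (D - L) :: 'a \<Rightarrow> real)"
    by (auto simp: less_top[symmetric])
  have intf: "integrable M ?f"
    by (rule integrable_bounded[where C=C]) (use bda in auto)
  have hbound: "\<bar>?h \<omega>\<bar> \<le> 3 * C" for \<omega>
  proof -
    have "\<bar>b \<omega> - a \<omega>\<bar> \<le> C" "\<bar>c \<omega> - a \<omega>\<bar> \<le> C" using bd[of \<omega>] by linarith+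
    moreover have "\<bar>p * X k \<omega>\<bar> \<le> 1" "\<bar>q * (1 - X k \<omega>)\<bar> \<le> 1"
      using X_bounds[of k \<omega>] pq by (auto simp: abs_mult mult_le_one)
    ultimately have "\<bar>p * X k \<omega> * (b \<omega> - a \<omega>)\<bar> \<le> 1 * C" "\<bar>q * (1 - X k \<omega>) * (c \<omega> - a \<omega>)\<bar> \<le> 1 * C"
      unfolding abs_mult[of _ "b \<omega> - a \<omega>"] abs_mult[of _ "c \<omega> - a \<omega>"] by (intro mult_mono; simp)+
    thus ?thesis using bd[of \<omega>] by linarith
  qed
  have inth: "integrable M ?h"
    by (rule integrable_bounded[where C="3 * C"]) (use hbound in auto)
  \<comment> \<open>The cap at time \<open>Suc k\<close> is dropped on \<open>E\<close>, while on
    \<open>D - L\<close> the process is bounded by 1.\<close>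
  have "expectation (\<lambda>\<omega>. indicator D \<omega> * capped_ratio e (Suc k) \<omega>)
      \<le> expectation (\<lambda>\<omega>. indicator (D - L) \<omega> + ?f \<omega>)"
  proof (intro integral_mono Bochner_Integration.integrable_add intW intI intf)
    fix \<omega> assume "\<omega> \<in> space M"
    show "indicator D \<omega> * capped_ratio e (Suc k) \<omega> \<le> indicator (D - L) \<omega> + ?f \<omega>"
    proof (cases "\<omega> \<in> E")
      case True
      have up: "X (Suc k) \<omega> = X k \<omega> + t * (1 - X k \<omega>)" if "\<omega> \<in> Up k"
        using that Up_Dn_disjoint[of k] by (auto simp: X_Suc t_def indicator_def)
      have dn: "X (Suc k) \<omega> = (1 - t) * X k \<omega>" if "\<omega> \<in> Dn k"
        using that Up_Dn_disjoint[of k] by (auto simp: X_Suc t_def indicator_def algebra_simps)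
      have no: "X (Suc k) \<omega> = X k \<omega>" if "\<omega> \<notin> Up k" "\<omega> \<notin> Dn k"
        using that by (simp add: X_Suc)
      have "capped_ratio e (Suc k) \<omega> \<le> s / X (Suc k) \<omega>"
        by (simp add: capped_ratio_def s_def)
      also have "\<dots> = ?f \<omega>" using True up dn no by (auto simp: a_def b_def c_def)
      finally show ?thesis using True by (auto simp: E_def)
    next
      case False
      hence "?f \<omega> = 0" by (simp add: a_def b_def c_def)
      thus ?thesis using False capped_ratio_bounds[OF e, of "Suc k" \<omega>]
        by (auto simp: E_def indicator_def)
    qed
  qed
  also have "\<dots> = expectation (indicator (D - L)) + expectation ?f"
    by (rule Bochner_Integration.integral_add[OF intI intf])
  also have "expectation ?f = expectation ?h"
    by (rule expectation_step[where C=C]) (use meas bda in auto)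
  also have "expectation (indicator (D - L)) + expectation ?h = expectation (\<lambda>\<omega>. indicator (D - L) \<omega> + ?h \<omega>)"
    by (rule Bochner_Integration.integral_add[OF intI inth, symmetric])
  \<comment> \<open>Nothing is lost on \<open>D - L\<close>, since the capped ratio at time
    \<open>k\<close> equals 1 there; on \<open>E\<close> the drift estimate gives the uncapped
    ratio, which is the capped one.\<close>
  also have "\<dots> \<le> expectation (\<lambda>\<omega>. indicator D \<omega> * capped_ratio e k \<omega>)"
  proof (rule integral_mono[OF Bochner_Integration.integrable_add[OF intI inth] intW])
    fix \<omega> assume w: "\<omega> \<in> space M"
    show "indicator (D - L) \<omega> + ?h \<omega> \<le> indicator D \<omega> * capped_ratio e k \<omega>"
    proof (cases "\<omega> \<in> E")
      case True
      hence le: "s + t\<^sup>2 \<le> X k \<omega>" by (simp add: E_def L_def)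
      have "?h \<omega> \<le> (s + t\<^sup>2) / X k \<omega>"
        using True reciprocal_drift_le[of "X k \<omega>" t q p s] le t s0 pq X_bounds[of k \<omega>]
        by (simp add: a_def b_def c_def)
      also have "\<dots> = capped_ratio e k \<omega>"
        using le X_bounds[of k \<omega>] by (simp add: capped_ratio_def S)
      finally show ?thesis using True by (auto simp: E_def)
    next
      case False
      hence "?h \<omega> = 0" by (simp add: a_def b_def c_def)
      moreover have "capped_ratio e k \<omega> = 1" if "\<omega> \<in> D"
        using that False w X_bounds[of k \<omega>] by (auto simp: E_def L_def capped_ratio_def S min_def)
      ultimately show ?thesis using False by (auto simp: E_def indicator_def)
    qed
  qed
  finally show ?thesis .
qed

lemma capped_ratio_supermartingale:
  assumes "0 < e" "D \<in> sets (F n)" "n \<le> k"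
  shows "expectation (\<lambda>\<omega>. indicator D \<omega> * capped_ratio e k \<omega>)
    \<le> expectation (\<lambda>\<omega>. indicator D \<omega> * capped_ratio e n \<omega>)"
  using assms(3)
proof (induction rule: dec_induct)
  case (step k)
  have "D \<in> sets (F k)" using sets_F_mono[OF step(1)] assms(2) by blast
  from capped_ratio_supermartingale_Suc[OF assms(1) this] step show ?case by linarith
qed simp

section \<open>Almost sure convergence of the martingale part\<close>

text \<open>The martingale part of the Doob decomposition of \<open>X\<close>: the conditional drift
  of step \<open>j\<close> is \<open>g j\<close> times
  \<open>p * X j * (1 - X j) - q * (1 - X j) * X j\<close>.\<close>

definition compensated :: "nat \<Rightarrow> 'a \<Rightarrow> real" where
  "compensated k \<omega> = X k \<omega> - (p - q) * (\<Sum>j<k. g j * (X j \<omega> * (1 - X j \<omega>)))"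

lemma compensated_measurable_F: "i \<le> k \<Longrightarrow> compensated i \<in> borel_measurable (F k)"
  unfolding compensated_def[abs_def]
  by (intro borel_measurable_diff borel_measurable_times borel_measurable_sum borel_measurable_const
      X_measurable_le) auto

lemma variance_bounds: "0 \<le> X k \<omega> * (1 - X k \<omega>)" "X k \<omega> * (1 - X k \<omega>) \<le> 1"
  using X_bounds[of k \<omega>] by (auto intro: mult_le_one)

lemma compensated_bounded: "\<bar>compensated k \<omega>\<bar> \<le> 1 + real k"
proof -
  have "\<bar>\<Sum>j<k. g j * (X j \<omega> * (1 - X j \<omega>))\<bar> \<le> (\<Sum>j<k. \<bar>g j * (X j \<omega> * (1 - X j \<omega>))\<bar>)"
    by (rule sum_abs)
  also have "\<dots> \<le> (\<Sum>j<k. 1)"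
  proof (rule sum_mono)
    fix j
    show "\<bar>g j * (X j \<omega> * (1 - X j \<omega>))\<bar> \<le> 1"
      using g_bounds[of j] variance_bounds[of j \<omega>] unfolding abs_mult[of "g j"]
      by (intro mult_le_one) auto
  qed
  finally have "\<bar>\<Sum>j<k. g j * (X j \<omega> * (1 - X j \<omega>))\<bar> \<le> real k" by simp
  hence "\<bar>p - q\<bar> * \<bar>\<Sum>j<k. g j * (X j \<omega> * (1 - X j \<omega>))\<bar> \<le> 1 * real k"
    using pq by (intro mult_mono) auto
  thus ?thesis using X_bounds[of k \<omega>]
    unfolding compensated_def abs_mult[symmetric] by linarith
qed

text \<open>The increment of the martingale at step \<open>k\<close> has conditional variance at
  most \<open>(g k)^2\<close>, which is exactly what \<open>g2_tail\<close> loses in that step.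
  Adding the tail thus turns the squared martingale increment since \<open>m\<close> into a
  supermartingale.\<close>

lemma compensated_square_Suc:
  assumes D: "D \<in> sets (F k)" and m: "m \<le> k"
  shows "expectation (\<lambda>\<omega>. indicator D \<omega> * ((compensated (Suc k) \<omega> - compensated m \<omega>)\<^sup>2 + g2_tail (Suc k)))
    \<le> expectation (\<lambda>\<omega>. indicator D \<omega> * ((compensated k \<omega> - compensated m \<omega>)\<^sup>2 + g2_tail k))"
proof -
  define u where "u \<omega> = compensated k \<omega> - compensated m \<omega>" for \<omega>
  define w where "w \<omega> = (p - q) * (X k \<omega> * (1 - X k \<omega>))" for \<omega>
  define t where "t = g k"
  define r where "r = g2_tail (Suc k)"
  have t: "0 < t" "t < 1" using g_bounds by (auto simp: t_def)
  have r: "0 \<le> r" "g2_tail k = r + t\<^sup>2" using g2_tail_nonneg g2_tail_Suc[of k] by (auto simp: r_def t_def)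
  \<comment> \<open>The three outcomes of the step; \<open>t * w\<close> is the compensator,
    subtracted in each of them.\<close>
  define a where "a \<omega> = indicator D \<omega> * ((u \<omega> - t * w \<omega>)\<^sup>2 + r)" for \<omega>
  define b where "b \<omega> = indicator D \<omega> * ((u \<omega> + t * (1 - X k \<omega>) - t * w \<omega>)\<^sup>2 + r)" for \<omega>
  define c where "c \<omega> = indicator D \<omega> * ((u \<omega> - t * X k \<omega> - t * w \<omega>)\<^sup>2 + r)" for \<omega>
  have um: "u \<in> borel_measurable (F k)" "w \<in> borel_measurable (F k)"
    unfolding u_def[abs_def] w_def[abs_def]
    using compensated_measurable_F[of k k] compensated_measurable_F[OF m] X_measurable_F[of k] by auto
  have meas: "a \<in> borel_measurable (F k)" "b \<in> borel_measurable (F k)" "c \<in> borel_measurable (F k)"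
    unfolding a_def[abs_def] b_def[abs_def] c_def[abs_def]
    using D X_measurable_F[of k] um by measurable
  \<comment> \<open>The bound for \<open>u\<close>, plus at most 1 for the move of \<open>X\<close>
    and at most 1 for the compensator.\<close>
  define K where "K = 2 * (1 + real k) + 2"
  have ub: "\<bar>u \<omega>\<bar> \<le> 2 * (1 + real k)" for \<omega>
  proof -
    have "\<bar>u \<omega>\<bar> \<le> \<bar>compensated k \<omega>\<bar> + \<bar>compensated m \<omega>\<bar>"
      unfolding u_def by (rule abs_triangle_ineq4)
    also have "\<dots> \<le> (1 + real k) + (1 + real m)"
      by (intro add_mono compensated_bounded)
    also have "\<dots> \<le> 2 * (1 + real k)" using m by simp
    finally show ?thesis .
  qed
  have wb: "0 \<le> t * w \<omega>" "t * w \<omega> \<le> 1" for \<omega>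
  proof -
    have "0 \<le> w \<omega>" "w \<omega> \<le> 1" using variance_bounds[of k \<omega>] pq by (auto simp: w_def intro!: mult_le_one)
    thus "0 \<le> t * w \<omega>" "t * w \<omega> \<le> 1" using t by (auto intro: mult_le_one)
  qed
  have tX: "0 \<le> t * X k \<omega>" "t * X k \<omega> \<le> 1" "0 \<le> t * (1 - X k \<omega>)" "t * (1 - X k \<omega>) \<le> 1" for \<omega>
    using X_bounds[of k \<omega>] t by (auto intro: mult_le_one)
  have sq: "\<bar>indicator D \<omega> * (z\<^sup>2 + r)\<bar> \<le> K\<^sup>2 + r" if "\<bar>z\<bar> \<le> K" for z \<omega>
  proof -
    have "z\<^sup>2 \<le> K\<^sup>2" using that by (metis abs_ge_zero power2_abs power_mono)
    thus ?thesis using r by (auto simp: indicator_def)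
  qed
  define C where "C = K\<^sup>2 + r"
  have bd: "\<bar>a \<omega>\<bar> \<le> C" "\<bar>b \<omega>\<bar> \<le> C" "\<bar>c \<omega>\<bar> \<le> C" for \<omega>
    unfolding a_def b_def c_def C_def
    by (rule sq; use ub[of \<omega>] wb[of \<omega>] tX[of \<omega>] in \<open>simp add: K_def; linarith\<close>)+
  have step: "indicator D \<omega> * ((compensated (Suc k) \<omega> - compensated m \<omega>)\<^sup>2 + r)
      = (if \<omega> \<in> Up k then b \<omega> else if \<omega> \<in> Dn k then c \<omega> else a \<omega>)" for \<omega>
    using Up_Dn_disjoint[of k]
    by (auto simp: compensated_def X_Suc a_def b_def c_def u_def w_def t_def algebra_simps)
  have "expectation (\<lambda>\<omega>. indicator D \<omega> * ((compensated (Suc k) \<omega> - compensated m \<omega>)\<^sup>2 + g2_tail (Suc k)))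
    = expectation (\<lambda>\<omega>. a \<omega> + p * X k \<omega> * (b \<omega> - a \<omega>) + q * (1 - X k \<omega>) * (c \<omega> - a \<omega>))"
    unfolding r_def[symmetric] step
    by (rule expectation_step[where C="C"]) (use meas bd in auto)
  also have "\<dots> \<le> expectation (\<lambda>\<omega>. indicator D \<omega> * ((u \<omega>)\<^sup>2 + (r + t\<^sup>2)))"
  proof (rule integral_mono)
    have DM: "D \<in> events" using D sets_F_subset by auto
    note [measurable] = um[THEN measurable_F_M] meas[THEN measurable_F_M] DM
    have "\<bar>indicator D \<omega> * ((u \<omega>)\<^sup>2 + (r + t\<^sup>2))\<bar> \<le> C + t\<^sup>2" for \<omega>
      using sq[of "u \<omega>" \<omega>] ub[of \<omega>] r by (auto simp: K_def C_def indicator_def)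
    thus "integrable M (\<lambda>\<omega>. indicator D \<omega> * ((u \<omega>)\<^sup>2 + (r + t\<^sup>2)))"
      by (intro integrable_bounded[where C="C + t\<^sup>2"]) auto
    have dd: "\<bar>b \<omega> - a \<omega>\<bar> \<le> 2 * C" "\<bar>c \<omega> - a \<omega>\<bar> \<le> 2 * C" for \<omega>
      using bd[of \<omega>] by (auto simp: abs_le_iff)
    have "\<bar>a \<omega> + p * X k \<omega> * (b \<omega> - a \<omega>) + q * (1 - X k \<omega>) * (c \<omega> - a \<omega>)\<bar> \<le> 5 * C" for \<omega>
    proof -
      have "\<bar>p * X k \<omega>\<bar> \<le> 1" "\<bar>q * (1 - X k \<omega>)\<bar> \<le> 1"
        using X_bounds[of k \<omega>] pq by (auto simp: abs_mult mult_le_one)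
      hence "\<bar>p * X k \<omega> * (b \<omega> - a \<omega>)\<bar> \<le> 1 * (2 * C)"
         "\<bar>q * (1 - X k \<omega>) * (c \<omega> - a \<omega>)\<bar> \<le> 1 * (2 * C)"
        using dd[of \<omega>] unfolding abs_mult[of _ "b \<omega> - a \<omega>"] abs_mult[of _ "c \<omega> - a \<omega>"]
        by (intro mult_mono; simp)+
      thus ?thesis using bd(1)[of \<omega>] by linarith
    qed
    thus "integrable M (\<lambda>\<omega>. a \<omega> + p * X k \<omega> * (b \<omega> - a \<omega>) + q * (1 - X k \<omega>) * (c \<omega> - a \<omega>))"
      by (intro integrable_bounded[where C="5 * C"]) auto
    fix \<omega> assume "\<omega> \<in> space M"
    define y where "y = X k \<omega>"
    have y: "0 < y" "y < 1" using X_bounds[of k \<omega>] by (auto simp: y_def)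
    \<comment> \<open>The terms linear in \<open>u\<close> vanish because \<open>w\<close> is the
      conditional mean of the move divided by \<open>t\<close>; the bracket after \<open>t^2\<close>
      is its conditional variance on the same scale.\<close>
    have "a \<omega> + p * X k \<omega> * (b \<omega> - a \<omega>) + q * (1 - X k \<omega>) * (c \<omega> - a \<omega>)
      = indicator D \<omega> * ((u \<omega>)\<^sup>2 + r + t\<^sup>2 * (p * y * (1 - y)\<^sup>2 + q * (1 - y) * y\<^sup>2 - (w \<omega>)\<^sup>2))"
      unfolding a_def b_def c_def w_def y_def[symmetric] by algebra
    also have "\<dots> \<le> indicator D \<omega> * ((u \<omega>)\<^sup>2 + r + t\<^sup>2 * 1)"
    proof (intro mult_left_mono add_left_mono)
      have "p * y * (1 - y)\<^sup>2 \<le> 1 * y * 1" using y pq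
        by (intro mult_mono) (auto simp: power_le_one)
      moreover have "q * (1 - y) * y\<^sup>2 \<le> 1 * (1 - y) * 1" using y pq
        by (intro mult_mono) (auto simp: power_le_one)
      ultimately have "p * y * (1 - y)\<^sup>2 + q * (1 - y) * y\<^sup>2 \<le> 1"
        using add_mono by fastforce
      thus "p * y * (1 - y)\<^sup>2 + q * (1 - y) * y\<^sup>2 - (w \<omega>)\<^sup>2 \<le> 1"
        using diff_left_mono[OF zero_le_power2[of "w \<omega>"]] by (metis diff_zero order_trans)
    qed auto
    finally show "a \<omega> + p * X k \<omega> * (b \<omega> - a \<omega>) + q * (1 - X k \<omega>) * (c \<omega> - a \<omega>)
      \<le> indicator D \<omega> * ((u \<omega>)\<^sup>2 + (r + t\<^sup>2))" by (simp add: add.assoc)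
  qed
  finally show ?thesis by (simp add: u_def r)
qed

lemma compensated_random [measurable]: "compensated k \<in> borel_measurable M"
  by (rule measurable_F_M[OF compensated_measurable_F[OF order_refl]])

text \<open>The maximal inequality is applied to the squared increment plus tail, whose value at
  time \<open>k\<close> is \<open>g2_tail k\<close> because the increment vanishes there. The finite
  horizons then increase to the full event.\<close>

lemma compensated_deviation:
  assumes e: "0 < e"
  shows "prob {\<omega>\<in>space M. \<exists>j\<ge>k. e \<le> \<bar>compensated j \<omega> - compensated k \<omega>\<bar>} \<le> g2_tail k / e\<^sup>2"
proof -
  define H where "H m = {\<omega>\<in>space M. \<exists>j\<in>{k..k + m}. e \<le> \<bar>compensated j \<omega> - compensated k \<omega>\<bar>}" for m
  have HM [measurable]: "H m \<in> events" for m unfolding H_def by measurable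
  have bound: "prob (H m) \<le> g2_tail k / e\<^sup>2" for m
  proof -
    \<comment> \<open>The maximal inequality asks for \<open>V j\<close> to be
      \<open>F j\<close>-measurable also before time \<open>k\<close>; \<open>min j k\<close>
      ensures this and equals \<open>k\<close> from time \<open>k\<close> on.\<close>
    define V where "V j \<omega> = (compensated j \<omega> - compensated (min j k) \<omega>)\<^sup>2 + g2_tail j" for j \<omega>
    have V_ge: "V j \<omega> = (compensated j \<omega> - compensated k \<omega>)\<^sup>2 + g2_tail j" if "k \<le> j" for j \<omega>
      using that by (simp add: V_def min_absorb2)
    have VF: "V j \<in> borel_measurable (F j)" for j
      unfolding V_def[abs_def]
      using compensated_measurable_F[of j j] compensated_measurable_F[of "min j k" j] by simp
    have "e\<^sup>2 * prob {\<omega>\<in>space M. \<exists>j\<in>{k..k + m}. e\<^sup>2 \<le> V j \<omega>} \<le> expectation (V k)"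
    proof (rule nonneg_supermartingale_maximal[where F=F])
      show "integrable M (V j)" for j
      proof (rule integrable_bounded)
        show "V j \<in> borel_measurable M" by (rule measurable_F_M[OF VF])
        show "\<bar>V j \<omega>\<bar> \<le> (2 * (1 + real j))\<^sup>2 + g2_tail j" for \<omega>
        proof -
          have "\<bar>compensated j \<omega> - compensated (min j k) \<omega>\<bar> \<le> \<bar>compensated j \<omega>\<bar> + \<bar>compensated (min j k) \<omega>\<bar>"
            by (rule abs_triangle_ineq4)
          also have "\<dots> \<le> (1 + real j) + (1 + real (min j k))"
            by (intro add_mono compensated_bounded)
          also have "\<dots> \<le> 2 * (1 + real j)" by simp
          finally have "\<bar>compensated j \<omega> - compensated (min j k) \<omega>\<bar>\<^sup>2 \<le> (2 * (1 + real j))\<^sup>2"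
            by (intro power_mono) auto
          thus ?thesis using g2_tail_nonneg[of j] by (simp add: V_def)
        qed
      qed
      show "0 \<le> V j \<omega>" for j \<omega> using g2_tail_nonneg[of j] by (simp add: V_def)
      show "expectation (\<lambda>\<omega>. indicator D \<omega> * V (Suc j) \<omega>) \<le> expectation (\<lambda>\<omega>. indicator D \<omega> * V j \<omega>)"
        if "k \<le> j" "D \<in> sets (F j)" for j D
        using compensated_square_Suc[OF that(2,1)] that by (simp add: V_ge)
    qed (auto intro: subalg VF sets_F_mono[THEN subsetD])
    also have "expectation (V k) = g2_tail k" by (simp add: V_def[abs_def] prob_space)
    finally have *: "prob {\<omega>\<in>space M. \<exists>j\<in>{k..k + m}. e\<^sup>2 \<le> V j \<omega>} \<le> g2_tail k / e\<^sup>2"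
      using e by (simp add: field_simps)
    have "prob (H m) \<le> prob {\<omega>\<in>space M. \<exists>j\<in>{k..k + m}. e\<^sup>2 \<le> V j \<omega>}"
    proof (rule finite_measure_mono)
      show "H m \<subseteq> {\<omega>\<in>space M. \<exists>j\<in>{k..k + m}. e\<^sup>2 \<le> V j \<omega>}"
      proof
        fix \<omega> assume "\<omega> \<in> H m"
        then obtain j where j: "\<omega> \<in> space M" "j \<in> {k..k+m}" "e \<le> \<bar>compensated j \<omega> - compensated k \<omega>\<bar>"
          by (auto simp: H_def)
        have "e\<^sup>2 \<le> \<bar>compensated j \<omega> - compensated k \<omega>\<bar>\<^sup>2" using j e by (intro power_mono) auto
        hence "e\<^sup>2 \<le> V j \<omega>" using j g2_tail_nonneg[of j] by (simp add: V_ge)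
        thus "\<omega> \<in> {\<omega>\<in>space M. \<exists>j\<in>{k..k + m}. e\<^sup>2 \<le> V j \<omega>}" using j by auto
      qed
      have [measurable]: "V j \<in> borel_measurable M" for j by (rule measurable_F_M[OF VF])
      show "{\<omega>\<in>space M. \<exists>j\<in>{k..k + m}. e\<^sup>2 \<le> V j \<omega>} \<in> events" by measurable
    qed
    with * show ?thesis by linarith
  qed
  have inc: "incseq H"
    by (rule incseq_SucI) (force simp: H_def)
  have "(\<lambda>m. prob (H m)) \<longlonglongrightarrow> prob (\<Union>m. H m)"
    by (rule finite_Lim_measure_incseq) (use HM inc in auto)
  hence "prob (\<Union>m. H m) \<le> g2_tail k / e\<^sup>2"
    by (rule LIMSEQ_le_const2) (use bound in auto)
  moreover have "(\<Union>m. H m) = {\<omega>\<in>space M. \<exists>j\<ge>k. e \<le> \<bar>compensated j \<omega> - compensated k \<omega>\<bar>}"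
    by (auto simp: H_def) (metis atLeastAtMost_iff le_Suc_ex order_refl)
  ultimately show ?thesis by simp
qed

text \<open>Deviations of size \<open>e\<close> that occur after every \<open>k\<close> have
  probability at most \<open>g2_tail k / e^2\<close> for all \<open>k\<close>, hence 0. Letting
  \<open>e\<close> run through the inverses of the positive integers shows that almost every path is
  Cauchy.\<close>

lemma AE_compensated_convergent: "AE \<omega> in M. convergent (\<lambda>k. compensated k \<omega>)"
proof -
  have "AE \<omega> in M. \<exists>k. \<forall>j\<ge>k. \<bar>compensated j \<omega> - compensated k \<omega>\<bar> < e" if e: "0 < e" for e
  proof -
    define B where "B = {\<omega>\<in>space M. \<forall>k. \<exists>j\<ge>k. e \<le> \<bar>compensated j \<omega> - compensated k \<omega>\<bar>}"
    have BM: "B \<in> events" unfolding B_def by measurable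
    have "prob B \<le> g2_tail k / e\<^sup>2" for k
    proof -
      have "prob B \<le> prob {\<omega>\<in>space M. \<exists>j\<ge>k. e \<le> \<bar>compensated j \<omega> - compensated k \<omega>\<bar>}"
        by (rule finite_measure_mono) (auto simp: B_def)
      with compensated_deviation[OF e, of k] show ?thesis by linarith
    qed
    moreover have "(\<lambda>k. g2_tail k / e\<^sup>2) \<longlonglongrightarrow> 0"
      using tendsto_divide[OF g2_tail_tendsto tendsto_const, of "e\<^sup>2"] e by simp
    ultimately have "prob B \<le> 0" by (intro LIMSEQ_le_const) auto
    hence "prob B = 0" by (simp add: measure_le_0_iff)
    hence "AE \<omega> in M. \<omega> \<notin> B"
      using BM prob_eq_0 by blast
    thus ?thesis by (rule AE_mp) (intro AE_I2, simp add: B_def, meson not_le)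
  qed
  hence "AE \<omega> in M. \<forall>i. \<exists>k. \<forall>j\<ge>k. \<bar>compensated j \<omega> - compensated k \<omega>\<bar> < inverse (real (Suc i))"
    by (subst AE_all_countable) auto
  thus ?thesis
  proof (rule AE_mp, intro AE_I2 impI)
    fix \<omega> assume *: "\<forall>i. \<exists>k. \<forall>j\<ge>k. \<bar>compensated j \<omega> - compensated k \<omega>\<bar> < inverse (real (Suc i))"
    have "Cauchy (\<lambda>k. compensated k \<omega>)"
    proof (rule metric_CauchyI)
      fix e :: real assume "0 < e"
      then obtain i where i: "inverse (real (Suc i)) < e / 2" using reals_Archimedean[of "e / 2"] by auto
      obtain k where k: "\<forall>j\<ge>k. \<bar>compensated j \<omega> - compensated k \<omega>\<bar> < inverse (real (Suc i))"
        using * by blast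
      have "dist (compensated j \<omega>) (compensated l \<omega>) < e" if "j \<ge> k" "l \<ge> k" for j l
      proof -
        have "dist (compensated j \<omega>) (compensated k \<omega>) < e / 2" "dist (compensated l \<omega>) (compensated k \<omega>) < e / 2"
          unfolding dist_real_def using k that i by (meson order_less_trans)+
        thus ?thesis by (rule dist_triangle_half_l)
      qed
      thus "\<exists>N. \<forall>m\<ge>N. \<forall>n\<ge>N. dist (compensated m \<omega>) (compensated n \<omega>) < e" by blast
    qed
    thus "convergent (\<lambda>k. compensated k \<omega>)" by (simp add: Cauchy_convergent_iff)
  qed
qed

section \<open>Almost sure convergence of the walk to 0 or 1\<close>

lemma expectation_X_Suc:
  "expectation (X (Suc k)) = expectation (X k) + (p - q) * g k * expectation (\<lambda>\<omega>. X k \<omega> * (1 - X k \<omega>))"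
proof -
  define t where "t = g k"
  have t: "0 < t" "t < 1" using g_bounds by (auto simp: t_def)
  have tX: "0 \<le> t * X k \<omega>" "t * X k \<omega> \<le> 1" "0 \<le> t * (1 - X k \<omega>)" "t * (1 - X k \<omega>) \<le> 1" for \<omega>
    using X_bounds[of k \<omega>] t by (auto intro: mult_le_one)
  have "expectation (X (Suc k)) = expectation (\<lambda>\<omega>. if \<omega> \<in> Up k then X k \<omega> + t * (1 - X k \<omega>)
      else if \<omega> \<in> Dn k then X k \<omega> - t * X k \<omega> else X k \<omega>)"
    using Up_Dn_disjoint[of k]
    by (intro Bochner_Integration.integral_cong) (auto simp: X_Suc t_def indicator_def)
  also have "\<dots> = expectation (\<lambda>\<omega>. X k \<omega> + p * X k \<omega> * (X k \<omega> + t * (1 - X k \<omega>) - X k \<omega>)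
      + q * (1 - X k \<omega>) * (X k \<omega> - t * X k \<omega> - X k \<omega>))"
  proof (rule expectation_step[where C=2])
    show "\<bar>X k \<omega>\<bar> \<le> 2" "\<bar>X k \<omega> + t * (1 - X k \<omega>)\<bar> \<le> 2" "\<bar>X k \<omega> - t * X k \<omega>\<bar> \<le> 2" for \<omega>
      using tX[of \<omega>] X_bounds[of k \<omega>] by (auto simp: abs_le_iff)
  qed (use X_measurable_F[of k] in auto)
  also have "\<dots> = expectation (\<lambda>\<omega>. X k \<omega> + (p - q) * t * (X k \<omega> * (1 - X k \<omega>)))"
    by (intro Bochner_Integration.integral_cong) (auto simp: algebra_simps)
  also have "\<dots> = expectation (X k) + (p - q) * t * expectation (\<lambda>\<omega>. X k \<omega> * (1 - X k \<omega>))"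
  proof -
    have "integrable M (X k)"
      by (rule integrable_bounded[where C=1]) (use X_bounds[of k] in \<open>auto simp: abs_le_iff less_imp_le intro: order_trans[of _ 0]\<close>)
    moreover have "integrable M (\<lambda>\<omega>. X k \<omega> * (1 - X k \<omega>))"
      by (rule integrable_bounded[where C=1]) (use variance_bounds[of k] in auto)
    ultimately show ?thesis by simp
  qed
  finally show ?thesis by (simp add: t_def)
qed

text \<open>Telescoping \<open>expectation_X_Suc\<close> bounds the expected partial sums by
  \<open>1 / (p - q)\<close>, as \<open>X\<close> stays in the unit interval. By monotone
  convergence the series has finite expectation, so it is finite almost surely.\<close>

lemma AE_summable_drift: "AE \<omega> in M. summable (\<lambda>k. g k * (X k \<omega> * (1 - X k \<omega>)))"
proof -
  have nonneg: "0 \<le> g k * (X k \<omega> * (1 - X k \<omega>))" for k \<omega>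
    using g_bounds[of k] by (intro mult_nonneg_nonneg[OF _ variance_bounds(1)]) auto
  have int: "integrable M (\<lambda>\<omega>. X k \<omega> * (1 - X k \<omega>))" for k
    by (rule integrable_bounded[where C=1]) (use variance_bounds[of k] in auto)
  have EX: "0 \<le> expectation (X k)" "expectation (X k) \<le> 1" for k
  proof -
    show "0 \<le> expectation (X k)" using X_bounds[of k] by (intro Bochner_Integration.integral_nonneg) (auto intro: less_imp_le)
    have "integrable M (X k)"
      by (rule integrable_bounded[where C=1]) (use X_bounds[of k] in \<open>auto simp: abs_le_iff less_imp_le intro: order_trans[of _ 0]\<close>)
    hence "expectation (X k) \<le> expectation (\<lambda>_. 1)"
      using X_bounds[of k] by (intro integral_mono) (auto intro: less_imp_le)
    thus "expectation (X k) \<le> 1" by (simp add: prob_space)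
  qed
  have "(\<Sum>k<n. g k * expectation (\<lambda>\<omega>. X k \<omega> * (1 - X k \<omega>))) \<le> 1 / (p - q)" for n
  proof -
    have "(p - q) * (\<Sum>k<n. g k * expectation (\<lambda>\<omega>. X k \<omega> * (1 - X k \<omega>)))
      = expectation (X n) - expectation (X 0)"
      by (induction n) (auto simp: expectation_X_Suc algebra_simps)
    also have "\<dots> \<le> 1" using EX[of n] EX[of 0] by linarith
    finally show ?thesis using pq by (simp add: field_simps)
  qed
  moreover have "(\<Sum>k<n. ennreal (g k * expectation (\<lambda>\<omega>. X k \<omega> * (1 - X k \<omega>))))
      = ennreal (\<Sum>k<n. g k * expectation (\<lambda>\<omega>. X k \<omega> * (1 - X k \<omega>)))" for n
    using g_bounds by (intro sum_ennreal mult_nonneg_nonneg Bochner_Integration.integral_nonneg variance_bounds)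
      (auto intro: less_imp_le)
  ultimately have bound: "(\<Sum>k<n. ennreal (g k * expectation (\<lambda>\<omega>. X k \<omega> * (1 - X k \<omega>)))) \<le> ennreal (1 / (p - q))" for n
    by (simp add: ennreal_leI)
  have "(\<integral>\<^sup>+\<omega>. (\<Sum>k. ennreal (g k * (X k \<omega> * (1 - X k \<omega>)))) \<partial>M)
      = (\<Sum>k. \<integral>\<^sup>+\<omega>. ennreal (g k * (X k \<omega> * (1 - X k \<omega>))) \<partial>M)"
    by (rule nn_integral_suminf) auto
  also have "\<dots> = (\<Sum>k. ennreal (g k * expectation (\<lambda>\<omega>. X k \<omega> * (1 - X k \<omega>))))"
  proof (rule suminf_cong)
    fix k
    show "(\<integral>\<^sup>+\<omega>. ennreal (g k * (X k \<omega> * (1 - X k \<omega>))) \<partial>M)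
      = ennreal (g k * expectation (\<lambda>\<omega>. X k \<omega> * (1 - X k \<omega>)))"
      using int[of k] nonneg by (subst nn_integral_eq_integral) auto
  qed
  also have "\<dots> \<le> ennreal (1 / (p - q))"
    by (rule suminf_le_const) (use bound in auto)
  finally have "(\<integral>\<^sup>+\<omega>. (\<Sum>k. ennreal (g k * (X k \<omega> * (1 - X k \<omega>)))) \<partial>M) \<noteq> \<infinity>"
    by (auto simp: top_unique)
  hence "AE \<omega> in M. (\<Sum>k. ennreal (g k * (X k \<omega> * (1 - X k \<omega>)))) \<noteq> \<infinity>"
    by (intro nn_integral_noteq_infinite) auto
  thus ?thesis
    by (rule AE_mp) (intro AE_I2 impI summable_suminf_not_top, auto simp: nonneg)
qed

text \<open>The martingale part and the accumulated drift both converge, hence so does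
  \<open>X\<close>. At a limit \<open>l\<close> strictly between 0 and 1 the drift terms would
  eventually exceed \<open>g k * (l * (1 - l) / 2)\<close>, and \<open>g\<close> would be
  summable.\<close>

lemma AE_tendsto_0_or_1: "AE \<omega> in M. (\<lambda>k. X k \<omega>) \<longlonglongrightarrow> 0 \<or> (\<lambda>k. X k \<omega>) \<longlonglongrightarrow> 1"
  using AE_compensated_convergent AE_summable_drift
proof eventually_elim
  case (elim \<omega>)
  have eq: "X k \<omega> = compensated k \<omega> + (p - q) * (\<Sum>j<k. g j * (X j \<omega> * (1 - X j \<omega>)))" for k
    by (simp add: compensated_def)
  have "convergent (\<lambda>k. \<Sum>j<k. g j * (X j \<omega> * (1 - X j \<omega>)))"
    using elim(2) by (simp add: summable_iff_convergent)
  hence "convergent (\<lambda>k. X k \<omega>)"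
    by (subst eq, intro convergent_add elim(1) convergent_mult convergent_const)
  then obtain l where l: "(\<lambda>k. X k \<omega>) \<longlonglongrightarrow> l" by (auto simp: convergent_def)
  have l01: "0 \<le> l" "l \<le> 1"
    by (rule LIMSEQ_le_const[OF l] LIMSEQ_le_const2[OF l], use X_bounds less_imp_le in blast)+
  have "l * (1 - l) = 0"
  proof (rule ccontr)
    assume "l * (1 - l) \<noteq> 0"
    hence pos: "0 < l * (1 - l)" using l01 by (auto simp: less_le)
    have "(\<lambda>k. X k \<omega> * (1 - X k \<omega>)) \<longlonglongrightarrow> l * (1 - l)" by (intro tendsto_intros l)
    hence "eventually (\<lambda>k. l * (1 - l) / 2 < X k \<omega> * (1 - X k \<omega>)) sequentially"
      using pos by (intro order_tendstoD(1)) auto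
    hence "eventually (\<lambda>k. norm (g k) \<le> (2 / (l * (1 - l))) * (g k * (X k \<omega> * (1 - X k \<omega>)))) sequentially"
    proof eventually_elim
      case (elim k)
      have "g k * (l * (1 - l) / 2) \<le> g k * (X k \<omega> * (1 - X k \<omega>))"
        using elim g_bounds[of k] by (intro mult_left_mono) auto
      thus ?case using pos g_bounds[of k] by (simp add: field_simps)
    qed
    hence "summable g"
      by (rule summable_comparison_test_ev) (intro summable_mult elim(2))
    with not_summable_g show False ..
  qed
  hence "l = 0 \<or> l = 1" by auto
  with l show ?case by auto
qed

section \<open>The conditional probability of missing the limit 1\<close>

text \<open>Almost every path in \<open>Q\<close> tends to 0, so eventually
  \<open>X k \<le> e\<close> and the capped ratio is 1. The probability is thus the limit of
  quantities dominated by the mean of the capped ratio at time \<open>k\<close>, which is at most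
  its mean at time \<open>n\<close>.\<close>

lemma prob_not_tendsto_1_le:
  assumes e: "0 < e" and D: "D \<in> sets (F n)"
    and Q: "Q \<in> events" "AE \<omega> in M. \<omega> \<in> Q \<longrightarrow> \<not> (\<lambda>k. X k \<omega>) \<longlonglongrightarrow> 1"
  shows "prob (D \<inter> Q) \<le> expectation (\<lambda>\<omega>. indicator D \<omega> * capped_ratio e n \<omega>)"
proof -
  have DM: "D \<in> events" using D sets_F_subset by auto
  note [measurable] = DM Q(1)
  define H where "H k = {\<omega>\<in>space M. X k \<omega> \<le> e}" for k
  have [measurable]: "H k \<in> events" for k unfolding H_def by measurable
  have capm [measurable]: "capped_ratio e j \<in> borel_measurable M" for j
    by (rule measurable_F_M[OF capped_ratio_measurable_F])
  \<comment> \<open>The events \<open>H k\<close> need not be monotone in \<open>k\<close>, so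
    dominated convergence takes the place of continuity of the measure.\<close>
  have "(\<lambda>k. expectation (indicator (D \<inter> Q \<inter> H k) :: 'a \<Rightarrow> real)) \<longlonglongrightarrow> expectation (indicator (D \<inter> Q) :: 'a \<Rightarrow> real)"
  proof (rule integral_dominated_convergence[where w="\<lambda>_. 1"])
    show "AE \<omega> in M. (\<lambda>k. indicator (D \<inter> Q \<inter> H k) \<omega> :: real) \<longlonglongrightarrow> indicator (D \<inter> Q) \<omega>"
      using AE_tendsto_0_or_1 Q(2) AE_space
    proof eventually_elim
      case (elim \<omega>)
      show ?case
      proof (cases "\<omega> \<in> D \<inter> Q")
        case True
        hence "(\<lambda>k. X k \<omega>) \<longlonglongrightarrow> 0" using elim by auto
        hence "eventually (\<lambda>k. X k \<omega> < e) sequentially" using e by (rule order_tendstoD)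
        hence "eventually (\<lambda>k. indicator (D \<inter> Q \<inter> H k) \<omega> = (indicator (D \<inter> Q) \<omega> :: real)) sequentially"
          by eventually_elim (use elim in \<open>auto simp: H_def indicator_def\<close>)
        thus ?thesis by (rule tendsto_eventually)
      next
        case False
        hence "\<omega> \<notin> D \<inter> Q \<inter> H k" for k by auto
        thus ?thesis using False by simp
      qed
    qed
  qed (auto simp: indicator_def)
  hence "(\<lambda>k. prob (D \<inter> Q \<inter> H k)) \<longlonglongrightarrow> prob (D \<inter> Q)"
    using sets.sets_into_space[OF DM] by (simp add: Int_absorb2 le_infI1)
  moreover have "prob (D \<inter> Q \<inter> H k) \<le> expectation (\<lambda>\<omega>. indicator D \<omega> * capped_ratio e n \<omega>)" if k: "n \<le> k" for k
  proof -
    have "prob (D \<inter> Q \<inter> H k) = expectation (indicator (D \<inter> Q \<inter> H k) :: 'a \<Rightarrow> real)"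
      using sets.sets_into_space[OF DM] by (simp add: Int_absorb2 le_infI1)
    also have "\<dots> \<le> expectation (\<lambda>\<omega>. indicator D \<omega> * capped_ratio e k \<omega>)"
    proof (rule integral_mono)
      show "integrable M (\<lambda>\<omega>. indicator D \<omega> * capped_ratio e k \<omega>)"
        by (rule integrable_bounded[where C=1])
          (use capped_ratio_bounds[OF e] in \<open>auto simp: indicator_def\<close>)
      fix \<omega>
      have "capped_ratio e k \<omega> = 1" if "X k \<omega> \<le> e"
        using that X_bounds[of k \<omega>] g2_tail_nonneg[of k] by (simp add: capped_ratio_def min_def)
      thus "indicator (D \<inter> Q \<inter> H k) \<omega> \<le> indicator D \<omega> * capped_ratio e k \<omega>"
        using capped_ratio_bounds[OF e, of k \<omega>] by (auto simp: indicator_def H_def)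
    qed (auto simp: less_top[symmetric])
    also have "\<dots> \<le> expectation (\<lambda>\<omega>. indicator D \<omega> * capped_ratio e n \<omega>)"
      by (rule capped_ratio_supermartingale[OF e D k])
    finally show ?thesis .
  qed
  ultimately show ?thesis by (intro LIMSEQ_le_const2) auto
qed

text \<open>The integrated bound of \<open>prob_not_tendsto_1_le\<close> is turned into a pointwise
  one for each fixed \<open>e\<close>, and then \<open>e\<close> tends to 0.\<close>

theorem cond_prob_not_tendsto_1_le:
  assumes Q: "Q \<in> events" "AE \<omega> in M. \<omega> \<in> Q \<longrightarrow> \<not> (\<lambda>k. X k \<omega>) \<longlonglongrightarrow> 1"
  shows "AE \<omega> in M. real_cond_exp M (F n) (indicator Q) \<omega> \<le> g2_tail n / X n \<omega>"
proof -
  interpret S: finite_measure_subalgebra M "F n" by (rule finite_measure_subalgebra_F)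
  have intQ: "integrable M (indicator Q :: 'a \<Rightarrow> real)" using Q(1) by (auto simp: less_top[symmetric])
  have *: "AE \<omega> in M. real_cond_exp M (F n) (indicator Q) \<omega> \<le> capped_ratio e n \<omega>" if e: "0 < e" for e
  proof -
    define R where "R = real_cond_exp M (F n) (indicator Q)"
    \<comment> \<open>The set where the desired inequality fails. It lies in \<open>F n\<close>, so
      the integrated bound applies to it and forces it to be null.\<close>
    define D where "D = {\<omega>\<in>space M. capped_ratio e n \<omega> < R \<omega>}"
    have RF: "R \<in> borel_measurable (F n)" by (simp add: R_def)
    have D: "D \<in> sets (F n)"
      unfolding D_def space_F[of n, symmetric]
      using RF capped_ratio_measurable_F[of e n] by (intro borel_measurable_less) auto
    have DM: "D \<in> events" using D sets_F_subset by auto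
    have intR: "integrable M R" unfolding R_def by (rule S.real_cond_exp_int(1)[OF intQ])
    have intc: "integrable M (capped_ratio e n)"
      by (rule integrable_bounded[where C=1])
        (use capped_ratio_bounds[OF e] measurable_F_M[OF capped_ratio_measurable_F] in auto)
    have iD: "integrable M (\<lambda>\<omega>. indicator D \<omega> * R \<omega>)" "integrable M (\<lambda>\<omega>. indicator D \<omega> * capped_ratio e n \<omega>)"
      using integrable_mult_indicator[OF DM intR] integrable_mult_indicator[OF DM intc] by auto
    have "expectation (\<lambda>\<omega>. indicator D \<omega> * R \<omega>) = expectation (\<lambda>\<omega>. indicator D \<omega> * indicator Q \<omega>)"
      using S.real_cond_exp_intA[OF intQ D] by (simp add: set_lebesgue_integral_def R_def)
    also have "\<dots> = expectation (indicator (D \<inter> Q) :: 'a \<Rightarrow> real)"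
      by (intro Bochner_Integration.integral_cong) (auto simp: indicator_def)
    also have "\<dots> = prob (D \<inter> Q)"
      using sets.sets_into_space[OF DM] by (simp add: Int_absorb2 le_infI1)
    also have "\<dots> \<le> expectation (\<lambda>\<omega>. indicator D \<omega> * capped_ratio e n \<omega>)"
      by (rule prob_not_tendsto_1_le[OF e D Q])
    finally have le: "expectation (\<lambda>\<omega>. indicator D \<omega> * R \<omega> - indicator D \<omega> * capped_ratio e n \<omega>) \<le> 0"
      using iD by simp
    have nn: "0 \<le> indicator D \<omega> * R \<omega> - indicator D \<omega> * capped_ratio e n \<omega>" for \<omega>
      by (auto simp: D_def indicator_def)
    have "expectation (\<lambda>\<omega>. indicator D \<omega> * R \<omega> - indicator D \<omega> * capped_ratio e n \<omega>) = 0"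
      using le nn by (intro antisym Bochner_Integration.integral_nonneg) auto
    hence "AE \<omega> in M. indicator D \<omega> * R \<omega> - indicator D \<omega> * capped_ratio e n \<omega> = 0"
      using integral_nonneg_eq_0_iff_AE[OF Bochner_Integration.integrable_diff[OF iD]] nn by auto
    thus ?thesis
      using AE_space by eventually_elim (auto simp: D_def R_def indicator_def split: if_splits)
  qed
  \<comment> \<open>Countably many values of \<open>e\<close> that tend to 0 share one null
    set.\<close>
  have "AE \<omega> in M. \<forall>i. real_cond_exp M (F n) (indicator Q) \<omega> \<le> capped_ratio (inverse (real (Suc i))) n \<omega>"
    using * by (subst AE_all_countable) auto
  thus ?thesis
  proof eventually_elim
    case (elim \<omega>)
    have "(\<lambda>i. (g2_tail n + inverse (real (Suc i))) / X n \<omega>) \<longlonglongrightarrow> (g2_tail n + 0) / X n \<omega>"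
      using X_bounds[of n \<omega>] by (intro tendsto_intros LIMSEQ_inverse_real_of_nat) auto
    moreover have "real_cond_exp M (F n) (indicator Q) \<omega> \<le> (g2_tail n + inverse (real (Suc i))) / X n \<omega>" for i
      using elim[rule_format, of i] by (simp add: capped_ratio_def)
    ultimately show ?case by (intro LIMSEQ_le_const) auto
  qed
qed

end

section \<open>Independence in the bandit model\<close>

text \<open>The index blocks \<open>{1..k}\<close> and \<open>{Suc k}\<close> are disjoint, so they
  generate independent sigma-algebras.\<close>

lemma (in prob_space) indep_vars_past:
  fixes Y :: "nat \<Rightarrow> 'a \<Rightarrow> 'b"
  assumes indep: "indep_vars (\<lambda>_. N) Y {1..}"
    and C: "C \<in> sigma_sets (space M) (\<Union>i\<in>{1..k}. {Y i -` S \<inter> space M | S. S \<in> sets N})"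
    and S: "S \<in> sets N"
  shows "prob (C \<inter> (Y (Suc k) -` S \<inter> space M)) = prob C * prob (Y (Suc k) -` S \<inter> space M)"
proof -
  let ?E = "\<lambda>i. {Y i -` S \<inter> space M | S. S \<in> sets N}"
  let ?I = "case_bool {1..k} {Suc k}"
  have "indep_sets (\<lambda>j. sigma_sets (space M) (\<Union>i\<in>?I j. ?E i)) UNIV"
  proof (rule indep_sets_collect_sigma)
    have "indep_sets ?E {1..}" using indep unfolding indep_vars_def2 by auto
    thus "indep_sets ?E (\<Union>j. ?I j)"
      by (rule indep_sets_mono_index[rotated]) (auto split: bool.splits)
    show "Int_stable (?E i)" for i
    proof (rule Int_stableI)
      fix a b assume "a \<in> ?E i" "b \<in> ?E i"
      then obtain S T where "a = Y i -` S \<inter> space M" "b = Y i -` T \<inter> space M" "S \<in> sets N" "T \<in> sets N" by auto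
      thus "a \<inter> b \<in> ?E i" by (auto intro!: exI[of _ "S \<inter> T"])
    qed
    show "disjoint_family_on ?I UNIV" by (auto simp: disjoint_family_on_def split: bool.splits)
  qed
  from indep_setsD[OF this, of UNIV "case_bool C (Y (Suc k) -` S \<inter> space M)"] C S
  show ?thesis by (auto simp: UNIV_bool ac_simps split: bool.splits)
qed

text \<open>Each coordinate factors through the whole sequence. This makes
  \<open>U_arms_indep\<close>, which is stated for whole sequences, applicable to finitely many
  coordinates.\<close>

lemma (in prob_space) sigma_sets_subset_vimage_algebra:
  fixes Y :: "nat \<Rightarrow> 'a \<Rightarrow> 'b :: topological_space"
  assumes "J \<subseteq> I"
  shows "sigma_sets (space M) (\<Union>i\<in>J. {Y i -` S \<inter> space M | S. S \<in> sets borel})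
    \<subseteq> sets (vimage_algebra (space M) (\<lambda>\<omega>. \<lambda>i\<in>I. Y i \<omega>) (PiM I (\<lambda>_. borel)))"
    (is "_ \<subseteq> sets ?V")
proof -
  have "(\<Union>i\<in>J. {Y i -` S \<inter> space M | S. S \<in> sets borel}) \<subseteq> sets ?V"
  proof safe
    fix i and S :: "'b set" assume i: "i \<in> J" and S: "S \<in> sets borel"
    have iI: "i \<in> I" using i assms by auto
    have "(\<lambda>\<omega>. \<lambda>i\<in>I. Y i \<omega>) \<in> ?V \<rightarrow>\<^sub>M PiM I (\<lambda>_. borel)"
      by (rule measurable_vimage_algebra1) (auto simp: space_PiM)
    from measurable_compose[OF this measurable_component_singleton[OF iI]]
    have "(\<lambda>\<omega>. (\<lambda>i\<in>I. Y i \<omega>) i) \<in> ?V \<rightarrow>\<^sub>M borel" .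
    hence "Y i \<in> ?V \<rightarrow>\<^sub>M borel" using iI by simp
    from measurable_sets[OF this S] show "Y i -` S \<inter> space M \<in> sets ?V" by simp
  qed
  from sets.sigma_sets_subset[OF this] show ?thesis by simp
qed

section \<open>The filtration, and independence of the next draw from the past\<close>

context two_armed_bandit
begin

abbreviation "\<F> \<equiv> bandit_filtration M U A B"

lemma U_random: "1 \<le> i \<Longrightarrow> U i \<in> borel_measurable M"
  using U_indep by (auto simp: indep_vars_def2)

lemma arms_random: "1 \<le> i \<Longrightarrow> arm_indicators A B i \<in> borel_measurable M"
  using arms_indep by (auto simp: indep_vars_def2)

lemma generators_subset:
  "{f -` S \<inter> space M | f S. S \<in> sets (borel :: real measure) \<and>
        f \<in> (\<Union>k\<in>{1..n}. {U k, indicator (A k), indicator (B k)})} \<subseteq> Pow (space M)"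
  by auto

lemma sets_filtration: "sets (\<F> n) = sigma_sets (space M)
   {f -` S \<inter> space M | f S. S \<in> sets (borel :: real measure) \<and>
        f \<in> (\<Union>k\<in>{1..n}. {U k, indicator (A k), indicator (B k)})}"
  unfolding bandit_filtration_def by (rule sets_measure_of[OF generators_subset])

lemma space_filtration: "space (\<F> n) = space M"
  unfolding bandit_filtration_def by (rule space_measure_of[OF generators_subset])

lemma filtration_generator_measurable:
  assumes "f \<in> (\<Union>k\<in>{1..n}. {U k, indicator (A k), indicator (B k)})"
  shows "f \<in> borel_measurable (\<F> n)"
proof (rule measurableI)
  fix S :: "real set" assume "S \<in> sets borel"
  thus "f -` S \<inter> space (\<F> n) \<in> sets (\<F> n)"
    unfolding space_filtration sets_filtration using assms by (intro sigma_sets.Basic) auto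
qed auto

lemma sets_filtration_mono: "m \<le> n \<Longrightarrow> sets (\<F> m) \<subseteq> sets (\<F> n)"
  unfolding sets_filtration by (rule sigma_sets_mono') force

lemma subalgebra_filtration: "subalgebra M (\<F> n)"
  unfolding subalgebra_def
proof
  show "sets (\<F> n) \<subseteq> events"
    unfolding sets_filtration
  proof (rule sets.sigma_sets_subset, clarify)
    fix f :: "'a \<Rightarrow> real" and S :: "real set" and k
    assume S: "S \<in> sets borel" and k: "k \<in> {1..n}" and f: "f \<in> {U k, indicator (A k), indicator (B k)}"
    have "f \<in> borel_measurable M"
      using f k U_random[of k] A_events[of k] B_events[of k] by auto
    from measurable_sets[OF this S] show "f -` S \<inter> space M \<in> events" .
  qed
qed (rule space_filtration)

text \<open>Independence holds first across the two sequences and then between past and next index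
  within each. Intersections of a past \<open>U\<close>-event with a past arm event form a pi-system
  whose sigma-algebra contains that of the history, which carries the product formula over to
  \<open>D\<close>.\<close>

lemma future_indep_of_history:
  assumes D: "D \<in> sets (\<F> k)" and S: "S \<in> sets borel" and G: "G \<in> sets borel"
  shows "prob (D \<inter> ((U (Suc k) -` S \<inter> space M) \<inter> (arm_indicators A B (Suc k) -` G \<inter> space M)))
    = prob D * (prob (U (Suc k) -` S \<inter> space M) * prob (arm_indicators A B (Suc k) -` G \<inter> space M))"
proof -
  let ?R = "arm_indicators A B"
  define PU where "PU J = sigma_sets (space M) (\<Union>i\<in>J. {U i -` S \<inter> space M | S. S \<in> sets borel})" for J
  define PR where "PR J = sigma_sets (space M) (\<Union>i\<in>J. {?R i -` S \<inter> space M | S. S \<in> sets borel})" for J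
  have PU_mono: "J \<subseteq> J' \<Longrightarrow> PU J \<subseteq> PU J'" for J J'
    unfolding PU_def by (rule sigma_sets_mono') auto
  have PR_mono: "J \<subseteq> J' \<Longrightarrow> PR J \<subseteq> PR J'" for J J'
    unfolding PR_def by (rule sigma_sets_mono') auto
  have PU_sub: "(\<Union>i\<in>J. {U i -` S \<inter> space M | S. S \<in> sets borel}) \<subseteq> Pow (space M)" for J by auto
  have PR_sub: "(\<Union>i\<in>J. {?R i -` S \<inter> space M | S. S \<in> sets borel}) \<subseteq> Pow (space M)" for J by auto
  interpret PU: sigma_algebra "space M" "PU J" for J
    unfolding PU_def by (rule sigma_algebra_sigma_sets[OF PU_sub])
  interpret PR: sigma_algebra "space M" "PR J" for J
    unfolding PR_def by (rule sigma_algebra_sigma_sets[OF PR_sub])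
  have indUR: "prob (a \<inter> b) = prob a * prob b" and evUR: "a \<in> events" "b \<in> events"
    if "a \<in> PU J" "b \<in> PR J" "J \<subseteq> {1..}" for a b J
  proof -
    have a: "a \<in> sets (vimage_algebra (space M) (\<lambda>\<omega>. \<lambda>n\<in>{1..}. U n \<omega>) (PiM {1..} (\<lambda>_. borel)))"
      using sigma_sets_subset_vimage_algebra[OF that(3), of U] that(1) unfolding PU_def by blast
    have b: "b \<in> sets (vimage_algebra (space M) (\<lambda>\<omega>. \<lambda>n\<in>{1..}. ?R n \<omega>) (PiM {1..} (\<lambda>_. borel)))"
      using sigma_sets_subset_vimage_algebra[OF that(3), of ?R] that(2) unfolding PR_def by blast
    show "prob (a \<inter> b) = prob a * prob b" by (rule indep_setD[OF U_arms_indep a b])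
    show "a \<in> events" "b \<in> events"
      using indep_setD_ev1[OF U_arms_indep] indep_setD_ev2[OF U_arms_indep] a b by blast+
  qed
  define u where "u = U (Suc k) -` S \<inter> space M"
  define r where "r = ?R (Suc k) -` G \<inter> space M"
  have u: "u \<in> PU {1..Suc k}" unfolding PU_def u_def using S by (intro sigma_sets.Basic UN_I[of "Suc k"]) auto
  have r: "r \<in> PR {1..Suc k}" unfolding PR_def r_def using G by (intro sigma_sets.Basic UN_I[of "Suc k"]) auto
  define P where "P = {C \<inter> E | C E. C \<in> PU {1..k} \<and> E \<in> PR {1..k}}"
  have indP: "indep_set P {u \<inter> r}"
  proof (rule indep_setI)
    show "P \<subseteq> events" unfolding P_def using evUR[of _ "{1..k}"] by auto
    show "{u \<inter> r} \<subseteq> events" using evUR[OF u r] by auto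
    fix a b assume "a \<in> P" and b: "b \<in> {u \<inter> r}"
    then obtain C E where a: "a = C \<inter> E" "C \<in> PU {1..k}" "E \<in> PR {1..k}" by (auto simp: P_def)
    have C: "C \<in> PU {1..Suc k}" using a PU_mono[of "{1..k}" "{1..Suc k}"] by auto
    have E: "E \<in> PR {1..Suc k}" using a PR_mono[of "{1..k}" "{1..Suc k}"] by auto
    \<comment> \<open>Regrouping by sequence rather than by time makes the independence of
      \<open>U\<close> from the arms applicable first.\<close>
    have "prob (a \<inter> b) = prob ((C \<inter> u) \<inter> (E \<inter> r))"
      using a b by (simp add: ac_simps)
    also have "\<dots> = prob (C \<inter> u) * prob (E \<inter> r)"
      by (rule indUR[of _ "{1..Suc k}"]) (use C E u r in auto)
    also have "prob (C \<inter> u) = prob C * prob u"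
      unfolding u_def by (rule indep_vars_past[OF U_indep a(2)[unfolded PU_def] S])
    also have "prob (E \<inter> r) = prob E * prob r"
      unfolding r_def by (rule indep_vars_past[OF arms_indep a(3)[unfolded PR_def] G])
    also have "prob C * prob u * (prob E * prob r) = (prob C * prob E) * (prob u * prob r)" by simp
    also have "\<dots> = prob a * prob b"
      using indUR[OF a(2,3)] indUR[OF u r] a b by simp
    finally show "prob (a \<inter> b) = prob a * prob b" .
  qed
  have "indep_set (sigma_sets (space M) P) (sigma_sets (space M) {u \<inter> r})"
  proof (rule indep_set_sigma_sets[OF indP])
    show "Int_stable P"
    proof (rule Int_stableI)
      fix a b assume "a \<in> P" "b \<in> P"
      then obtain C E C' E' where "a = C \<inter> E" "C \<in> PU {1..k}" "E \<in> PR {1..k}"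
        "b = C' \<inter> E'" "C' \<in> PU {1..k}" "E' \<in> PR {1..k}" unfolding P_def by blast
      hence "a \<inter> b = (C \<inter> C') \<inter> (E \<inter> E')" "C \<inter> C' \<in> PU {1..k}" "E \<inter> E' \<in> PR {1..k}" by auto
      thus "a \<inter> b \<in> P" unfolding P_def by blast
    qed
  qed (auto simp: Int_stable_def)
  moreover have "D \<in> sigma_sets (space M) P"
  proof -
    have "{f -` S \<inter> space M | f S. S \<in> sets (borel :: real measure) \<and>
        f \<in> (\<Union>k\<in>{1..k}. {U k, indicator (A k), indicator (B k)})} \<subseteq> P"
    proof clarify
      fix f :: "'a \<Rightarrow> real" and T :: "real set" and i
      assume T: "T \<in> sets borel" and i: "i \<in> {1..k}" and f: "f \<in> {U i, indicator (A i), indicator (B i)}"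
      \<comment> \<open>Each indicator is a projection of the pair, so every generator of the
        history is a one-sided member of \<open>P\<close>, with \<open>space M\<close> as the other
        factor.\<close>
      from f consider "f = U i" | "f = fst \<circ> ?R i" | "f = snd \<circ> ?R i"
        by (auto simp: arm_indicators_def fun_eq_iff)
      thus "f -` T \<inter> space M \<in> P"
      proof cases
        case 1
        hence "f -` T \<inter> space M \<in> PU {1..k}"
          unfolding PU_def using T i by (intro sigma_sets.Basic UN_I[of i]) auto
        hence "(f -` T \<inter> space M) \<inter> space M \<in> P" unfolding P_def using PR.top by blast
        thus ?thesis by simp
      next
        case 2
        have "fst -` T \<in> sets (borel :: (real \<times> real) measure)"
          using measurable_sets_borel[OF borel_measurable_continuous_onI[OF continuous_on_fst[OF continuous_on_id]] T] by simp
        hence "?R i -` (fst -` T) \<inter> space M \<in> PR {1..k}"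
          unfolding PR_def using i by (intro sigma_sets.Basic UN_I[of i]) auto
        hence "space M \<inter> (?R i -` (fst -` T) \<inter> space M) \<in> P" unfolding P_def using PU.top by blast
        thus ?thesis by (simp add: 2 vimage_comp Int_absorb1)
      next
        case 3
        have "snd -` T \<in> sets (borel :: (real \<times> real) measure)"
          using measurable_sets_borel[OF borel_measurable_continuous_onI[OF continuous_on_snd[OF continuous_on_id]] T] by simp
        hence "?R i -` (snd -` T) \<inter> space M \<in> PR {1..k}"
          unfolding PR_def using i by (intro sigma_sets.Basic UN_I[of i]) auto
        hence "space M \<inter> (?R i -` (snd -` T) \<inter> space M) \<in> P" unfolding P_def using PU.top by blast
        thus ?thesis by (simp add: 3 vimage_comp Int_absorb1)
      qed
    qed
    hence "sets (\<F> k) \<subseteq> sigma_sets (space M) P"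
      unfolding sets_filtration by (rule sigma_sets_mono')
    with D show ?thesis by blast
  qed
  ultimately have "prob (D \<inter> (u \<inter> r)) = prob D * prob (u \<inter> r)"
    by (rule indep_setD) (auto intro: sigma_sets.Basic)
  thus ?thesis using indUR[OF u r] by (simp add: u_def r_def)
qed

section \<open>Marginal laws of the uniforms and of the arms\<close>

lemma prob_U_le:
  assumes "1 \<le> k" "0 \<le> v" "v \<le> 1" shows "prob (U k -` {..v} \<inter> space M) = v"
proof -
  have "prob (U k -` {..v} \<inter> space M) = measure (distr M borel (U k)) {..v}"
    using U_random[OF assms(1)] by (simp add: measure_distr)
  also have "\<dots> = measure lborel ({0..1} \<inter> {..v})"
    using assms by (simp add: U_uniform)
  also have "{0..1} \<inter> {..v} = {0..v}" using assms by auto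
  finally show ?thesis using assms by simp
qed

lemma prob_U_gt:
  assumes "1 \<le> k" "0 \<le> v" "v \<le> 1" shows "prob (U k -` {v<..} \<inter> space M) = 1 - v"
proof -
  have "prob (space M - (U k -` {..v} \<inter> space M)) = 1 - prob (U k -` {..v} \<inter> space M)"
    using U_random[OF assms(1)] by (intro prob_compl) (auto intro: measurable_sets)
  moreover have "space M - (U k -` {..v} \<inter> space M) = U k -` {v<..} \<inter> space M" by auto
  ultimately show ?thesis using assms by (simp add: prob_U_le)
qed

text \<open>Independence and equality in law are assumed for the pairs of indicators, so the arm
  events are expressed through the pair.\<close>

lemma A_eq_vimage: "1 \<le> k \<Longrightarrow> A k = arm_indicators A B k -` ({1} \<times> UNIV) \<inter> space M"
  using sets.sets_into_space[OF A_events[of k]] by (auto simp: arm_indicators_def indicator_def split: if_splits)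

lemma B_eq_vimage: "1 \<le> k \<Longrightarrow> B k = arm_indicators A B k -` (UNIV \<times> {1}) \<inter> space M"
  using sets.sets_into_space[OF B_events[of k]] by (auto simp: arm_indicators_def indicator_def split: if_splits)

lemma borel_arm_sets:
  "{1} \<times> UNIV \<in> sets (borel :: (real \<times> real) measure)" "UNIV \<times> {1} \<in> sets (borel :: (real \<times> real) measure)"
  by (auto intro!: borel_closed closed_Times)

lemma prob_arms_eq:
  assumes "1 \<le> k" "G \<in> sets borel"
  shows "prob (arm_indicators A B k -` G \<inter> space M) = prob (arm_indicators A B 1 -` G \<inter> space M)"
  using arms_identical[OF assms(1)] measure_distr[OF arms_random[OF assms(1)] assms(2)]
    measure_distr[OF arms_random[of 1] assms(2)] by simp

lemma prob_A_eq: "1 \<le> k \<Longrightarrow> prob (A k) = pA"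
  using prob_arms_eq[OF _ borel_arm_sets(1), of k] prob_A by (simp flip: A_eq_vimage)

lemma prob_B_eq: "1 \<le> k \<Longrightarrow> prob (B k) = pB"
  using prob_arms_eq[OF _ borel_arm_sets(2), of k] prob_B by (simp flip: B_eq_vimage)

section \<open>The bandit started inside the unit interval as a reinforced walk\<close>

context
  fixes x :: real
  assumes x: "x \<in> {0<..<1}"
begin

abbreviation "X \<equiv> bandit U A B \<gamma> x"

text \<open>Indexed by the time before the step, as in \<open>reinforced_walk\<close>, while the
  draw has index \<open>Suc k\<close>. The restriction to \<open>space M\<close> makes it an
  event.\<close>

definition up_event :: "nat \<Rightarrow> 'a set" where
  "up_event k = {\<omega>\<in>space M. U (Suc k) \<omega> \<le> X k \<omega>} \<inter> A (Suc k)"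

definition down_event :: "nat \<Rightarrow> 'a set" where
  "down_event k = {\<omega>\<in>space M. U (Suc k) \<omega> > X k \<omega>} \<inter> B (Suc k)"

lemma up_down_disjoint: "up_event k \<inter> down_event k = {}"
  by (auto simp: up_event_def down_event_def)

lemma X_step: "X (Suc k) \<omega> = X k \<omega> + \<gamma> (Suc k) *
    ((1 - X k \<omega>) * indicator (up_event k) \<omega> - X k \<omega> * indicator (down_event k) \<omega>)"
proof -
  have "{\<omega>. U (Suc k) \<omega> \<le> X k \<omega>} \<inter> A (Suc k) = up_event k"
    using sets.sets_into_space[OF A_events[of "Suc k"]] by (auto simp: up_event_def)
  moreover have "{\<omega>. U (Suc k) \<omega> > X k \<omega>} \<inter> B (Suc k) = down_event k"
    using sets.sets_into_space[OF B_events[of "Suc k"]] by (auto simp: down_event_def)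
  ultimately show ?thesis by simp
qed

text \<open>A step moves \<open>X\<close> by a fraction strictly below 1 of its distance to 0 or to
  1, and never in both directions at once.\<close>

lemma X_range: "0 < X k \<omega> \<and> X k \<omega> < 1"
proof (induction k)
  case (Suc k)
  define t where "t = \<gamma> (Suc k)"
  have t: "0 < t" "t < 1" using step_range[of "Suc k"] by (auto simp: t_def)
  define y where "y = X k \<omega>"
  have y: "0 < y" "y < 1" using Suc by (auto simp: y_def)
  have "X (Suc k) \<omega> \<in> {y + t * (1 - y), y - t * y, y}"
    unfolding X_step t_def y_def using up_down_disjoint[of k] by (auto simp: indicator_def)
  moreover have "0 < t * (1 - y)" "t * (1 - y) < 1 - y" "0 < t * y" "t * y < y" using t y by auto
  hence "0 < y + t * (1 - y) \<and> y + t * (1 - y) < 1" "0 < y - t * y \<and> y - t * y < 1"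
    using y by linarith+
  ultimately show ?case using y by (metis insertE singletonD)
qed (use x in auto)

text \<open>From each state the two indicators allow finitely many successors. This prepares the
  conditioning on the exact value of \<open>X k\<close> below.\<close>

lemma finite_range_X: "finite (range (X k))"
proof (induction k)
  case (Suc k)
  have "range (X (Suc k)) \<subseteq> (\<lambda>(y, a, b). y + \<gamma> (Suc k) * ((1 - y) * a - y * b)) ` (range (X k) \<times> {0, 1} \<times> {0, 1})"
    unfolding X_step by (force simp: indicator_def)
  thus ?case by (rule finite_subset) (use Suc in auto)
qed simp

lemma X_measurable_filtration: "X k \<in> borel_measurable (\<F> k)"
proof (induction k)
  case (Suc k)
  have sub: "subalgebra (\<F> (Suc k)) (\<F> k)"
    using sets_filtration_mono[of k "Suc k"] by (simp add: subalgebra_def space_filtration)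
  have [measurable]: "X k \<in> borel_measurable (\<F> (Suc k))"
    by (rule measurable_from_subalg[OF sub Suc])
  have [measurable]: "U (Suc k) \<in> borel_measurable (\<F> (Suc k))"
    "(indicator (A (Suc k)) :: 'a \<Rightarrow> real) \<in> borel_measurable (\<F> (Suc k))"
    "(indicator (B (Suc k)) :: 'a \<Rightarrow> real) \<in> borel_measurable (\<F> (Suc k))"
    by (intro filtration_generator_measurable UN_I[of "Suc k"]; simp)+
  have "X (Suc k) = (\<lambda>\<omega>. X k \<omega> + \<gamma> (Suc k) *
      ((1 - X k \<omega>) * ((if U (Suc k) \<omega> \<le> X k \<omega> then 1 else 0) * indicator (A (Suc k)) \<omega>)
       - X k \<omega> * ((if X k \<omega> < U (Suc k) \<omega> then 1 else 0) * indicator (B (Suc k)) \<omega>)))"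
    by (auto simp: fun_eq_iff indicator_def)
  also have "\<dots> \<in> borel_measurable (\<F> (Suc k))" by measurable
  finally show ?case .
qed simp

lemma X_random: "X k \<in> borel_measurable M"
  by (rule measurable_from_subalg[OF subalgebra_filtration X_measurable_filtration])

lemma up_event_events: "up_event k \<in> events" and down_event_events: "down_event k \<in> events"
proof -
  have [measurable]: "X k \<in> borel_measurable M" "U (Suc k) \<in> borel_measurable M"
    "A (Suc k) \<in> events" "B (Suc k) \<in> events"
    using X_random U_random A_events B_events by auto
  show "up_event k \<in> events" "down_event k \<in> events"
    unfolding up_event_def down_event_def by measurable
qed

text \<open>As \<open>X k\<close> takes finitely many values, freezing it at each of them replaces the usual
  disintegration argument.\<close>
lemma prob_history_step:
  assumes D: "D \<in> sets (\<F> k)"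
    and S: "\<And>v. S v \<in> sets borel"
    and G: "G \<in> sets borel"
    and \<rho>: "\<And>v. 0 < v \<Longrightarrow> v < 1 \<Longrightarrow> prob (U (Suc k) -` S v \<inter> space M) = \<rho> v"
    and c: "c = prob (arm_indicators A B (Suc k) -` G \<inter> space M)"
  shows "prob (D \<inter> {\<omega>\<in>space M. U (Suc k) \<omega> \<in> S (X k \<omega>)} \<inter> (arm_indicators A B (Suc k) -` G \<inter> space M))
    = expectation (\<lambda>\<omega>. indicator D \<omega> * (c * \<rho> (X k \<omega>)))"
proof -
  define V where "V = range (X k)"
  have V: "finite V" using finite_range_X by (simp add: V_def)
  have V01: "0 < v \<and> v < 1" if "v \<in> V" for v using that X_range by (auto simp: V_def)
  define K where "K v = D \<inter> (X k -` {v} \<inter> space M)" for v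
  have KF: "K v \<in> sets (\<F> k)" for v
    using D measurable_sets[OF X_measurable_filtration[of k], of "{v}"]
    by (auto simp: K_def space_filtration)
  have sub: "sets (\<F> k) \<subseteq> events" using subalgebra_filtration[of k] by (simp add: subalgebra_def)
  have KM: "K v \<in> events" for v using KF sub by blast
  have DM: "D \<in> events" using D sub by blast
  define H where "H v = (U (Suc k) -` S v \<inter> space M) \<inter> (arm_indicators A B (Suc k) -` G \<inter> space M)" for v
  have HM: "H v \<in> events" for v
    unfolding H_def using measurable_sets[OF U_random S] measurable_sets[OF arms_random G] by auto
  let ?L = "D \<inter> {\<omega>\<in>space M. U (Suc k) \<omega> \<in> S (X k \<omega>)} \<inter> (arm_indicators A B (Suc k) -` G \<inter> space M)"
  have L: "?L = (\<Union>v\<in>V. K v \<inter> H v)"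
    by (auto simp: K_def H_def V_def)
  have "prob ?L = (\<Sum>v\<in>V. prob (K v \<inter> H v))"
    unfolding L using KM HM
    by (intro finite_measure_finite_Union V) (auto simp: disjoint_family_on_def K_def)
  also have "\<dots> = (\<Sum>v\<in>V. prob (K v) * (\<rho> v * c))"
    unfolding H_def using future_indep_of_history[OF KF S G] V01 \<rho> by (intro sum.cong) (auto simp: c)
  also have "\<dots> = (\<Sum>v\<in>V. expectation (\<lambda>\<omega>. indicator (K v) \<omega> * (c * \<rho> v)))"
    using sets.sets_into_space[OF KM] by (intro sum.cong) (auto simp: Int_absorb2)
  also have "\<dots> = expectation (\<lambda>\<omega>. \<Sum>v\<in>V. indicator (K v) \<omega> * (c * \<rho> v))"
    using KM by (intro Bochner_Integration.integral_sum[symmetric]) (auto simp: less_top[symmetric])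
  also have "\<dots> = expectation (\<lambda>\<omega>. indicator D \<omega> * (c * \<rho> (X k \<omega>)))"
  proof (intro Bochner_Integration.integral_cong refl)
    fix \<omega> assume "\<omega> \<in> space M"
    hence "(\<Sum>v\<in>V. indicator (K v) \<omega> * (c * \<rho> v)) = (\<Sum>v\<in>V. if v = X k \<omega> then indicator D \<omega> * (c * \<rho> v) else 0)"
      by (intro sum.cong) (auto simp: K_def indicator_def)
    also have "\<dots> = indicator D \<omega> * (c * \<rho> (X k \<omega>))" using V by (simp add: V_def)
    finally show "(\<Sum>v\<in>V. indicator (K v) \<omega> * (c * \<rho> v)) = indicator D \<omega> * (c * \<rho> (X k \<omega>))" .
  qed
  finally show ?thesis .
qed

lemma prob_up_event:
  assumes "D \<in> sets (\<F> k)"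
  shows "prob (D \<inter> up_event k) = expectation (\<lambda>\<omega>. indicator D \<omega> * (pA * X k \<omega>))"
proof -
  have "prob (D \<inter> {\<omega>\<in>space M. U (Suc k) \<omega> \<in> {..X k \<omega>}} \<inter> (arm_indicators A B (Suc k) -` ({1} \<times> UNIV) \<inter> space M))
    = expectation (\<lambda>\<omega>. indicator D \<omega> * (pA * X k \<omega>))"
    by (rule prob_history_step[OF assms])
      (use borel_arm_sets in \<open>auto simp: prob_U_le prob_A_eq simp flip: A_eq_vimage\<close>)
  thus ?thesis by (simp add: up_event_def Int_assoc flip: A_eq_vimage)
qed

lemma prob_down_event:
  assumes "D \<in> sets (\<F> k)"
  shows "prob (D \<inter> down_event k) = expectation (\<lambda>\<omega>. indicator D \<omega> * (pB * (1 - X k \<omega>)))"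
proof -
  have "prob (D \<inter> {\<omega>\<in>space M. U (Suc k) \<omega> \<in> {X k \<omega><..}} \<inter> (arm_indicators A B (Suc k) -` (UNIV \<times> {1}) \<inter> space M))
    = expectation (\<lambda>\<omega>. indicator D \<omega> * (pB * (1 - X k \<omega>)))"
    by (rule prob_history_step[OF assms])
      (use borel_arm_sets in \<open>auto simp: prob_U_gt prob_B_eq simp flip: B_eq_vimage\<close>)
  thus ?thesis by (simp add: down_event_def Int_assoc flip: B_eq_vimage)
qed

lemma not_summable_steps: "\<not> summable (\<lambda>k. \<gamma> (Suc k))"
proof
  assume "summable (\<lambda>k. \<gamma> (Suc k))"
  hence "(\<Sum>k. ereal (\<gamma> (Suc k))) = ereal (\<Sum>k. \<gamma> (Suc k))"
    by (intro sums_unique[symmetric]) (simp add: sums_ereal summable_sums)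
  thus False using step_sum by simp
qed

lemma walk_pA_gt:
  assumes "pB < pA" "summable (\<lambda>k. (\<gamma> (Suc k))\<^sup>2)"
  shows "reinforced_walk M \<F> X up_event down_event (\<lambda>k. \<gamma> (Suc k)) pA pB"
proof unfold_locales
  show "sets (\<F> k) \<subseteq> sets (\<F> (Suc k))" for k by (rule sets_filtration_mono) simp
  show "0 \<le> pB" "pA \<le> 1" using prob_A prob_B by auto
  show "0 < \<gamma> (Suc k) \<and> \<gamma> (Suc k) < 1" for k using step_range[of "Suc k"] by auto
qed (use assms subalgebra_filtration X_measurable_filtration X_range up_event_events
    down_event_events up_down_disjoint X_step prob_up_event prob_down_event not_summable_steps in blast)+

text \<open>\<open>1 - X\<close> moves up with probability \<open>pB * (1 - X)\<close> and down with
  probability \<open>pA * X\<close>, so it is the walk with the two probabilities exchanged.\<close>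

lemma walk_pA_less:
  assumes "pA < pB" "summable (\<lambda>k. (\<gamma> (Suc k))\<^sup>2)"
  shows "reinforced_walk M \<F> (\<lambda>k \<omega>. 1 - X k \<omega>) down_event up_event (\<lambda>k. \<gamma> (Suc k)) pB pA"
proof unfold_locales
  show "sets (\<F> k) \<subseteq> sets (\<F> (Suc k))" for k by (rule sets_filtration_mono) simp
  show "0 \<le> pA" "pB \<le> 1" using prob_A prob_B by auto
  show "0 < \<gamma> (Suc k) \<and> \<gamma> (Suc k) < 1" for k using step_range[of "Suc k"] by auto
  show "(\<lambda>\<omega>. 1 - X k \<omega>) \<in> borel_measurable (\<F> k)" for k
    using X_measurable_filtration[of k] by simp
  show "0 < 1 - X k \<omega> \<and> 1 - X k \<omega> < 1" for k \<omega> using X_range[of k \<omega>] by simp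
  show "down_event k \<inter> up_event k = {}" for k using up_down_disjoint by blast
  show "1 - X (Suc k) \<omega> = 1 - X k \<omega> + \<gamma> (Suc k) *
      ((1 - (1 - X k \<omega>)) * indicator (down_event k) \<omega> - (1 - X k \<omega>) * indicator (up_event k) \<omega>)" for k \<omega>
    unfolding X_step by (simp add: algebra_simps)
  show "prob (D \<inter> up_event k) = expectation (\<lambda>\<omega>. indicator D \<omega> * (pA * (1 - (1 - X k \<omega>))))"
    if "D \<in> sets (\<F> k)" for D k using prob_up_event[OF that] by simp
qed (use assms subalgebra_filtration up_event_events down_event_events prob_down_event
    not_summable_steps in blast)+

lemma limit_event: "{\<omega>\<in>space M. bandit_limit U A B \<gamma> x \<omega> \<noteq> c} \<in> events"
proof -
  have [measurable]: "X k \<in> borel_measurable M" for k by (rule X_random)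
  have [measurable]: "bandit_limit U A B \<gamma> x \<in> borel_measurable M"
    unfolding bandit_limit_def[abs_def] by measurable
  show ?thesis by measurable
qed

text \<open>Provides the trivial half of the bound; it is all that is needed when the squared steps
  are not summable.\<close>

lemma cond_prob_limit_le_1:
  "AE \<omega> in M. cond_prob_subalg M (\<F> n) (\<lambda>\<omega>. bandit_limit U A B \<gamma> x \<omega> \<noteq> c) \<omega> \<le> 1"
proof -
  interpret S: finite_measure_subalgebra M "\<F> n"
    by unfold_locales (rule subalgebra_filtration)
  show ?thesis
    unfolding cond_prob_subalg_def
    by (rule S.real_cond_exp_le_c) (use limit_event in \<open>auto simp: indicator_def less_top[symmetric]\<close>)
qed

lemma cond_prob_limit_ne_1_le:
  assumes "pB < pA" and sm: "summable (\<lambda>k. (\<gamma> (Suc k))\<^sup>2)"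
  shows "AE \<omega> in M. cond_prob_subalg M (\<F> n) (\<lambda>\<omega>. bandit_limit U A B \<gamma> x \<omega> \<noteq> 1) \<omega>
    \<le> (\<Sum>j. (\<gamma> (Suc (j + n)))\<^sup>2) / X n \<omega>"
proof -
  interpret W: reinforced_walk M \<F> X up_event down_event "\<lambda>k. \<gamma> (Suc k)" pA pB
    by (rule walk_pA_gt[OF assms])
  \<comment> \<open>Convergence to 1 forces the value of \<open>lim\<close>, so the event contains
    no path that tends to 1, whatever \<open>lim\<close> returns on divergent paths.\<close>
  show ?thesis
    unfolding cond_prob_subalg_def W.g2_tail_def[symmetric]
    by (rule W.cond_prob_not_tendsto_1_le[OF limit_event]) (auto simp: bandit_limit_def limI)
qed

lemma cond_prob_limit_ne_0_le:
  assumes "pA < pB" and sm: "summable (\<lambda>k. (\<gamma> (Suc k))\<^sup>2)"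
  shows "AE \<omega> in M. cond_prob_subalg M (\<F> n) (\<lambda>\<omega>. bandit_limit U A B \<gamma> x \<omega> \<noteq> 0) \<omega>
    \<le> (\<Sum>j. (\<gamma> (Suc (j + n)))\<^sup>2) / (1 - X n \<omega>)"
proof -
  interpret W: reinforced_walk M \<F> "\<lambda>k \<omega>. 1 - X k \<omega>" down_event up_event "\<lambda>k. \<gamma> (Suc k)" pB pA
    by (rule walk_pA_less[OF assms])
  have "(\<lambda>k. X k \<omega>) \<longlonglongrightarrow> 0" if "(\<lambda>k. 1 - X k \<omega>) \<longlonglongrightarrow> 1" for \<omega>
    using tendsto_diff[OF tendsto_const[of 1] that] by simp
  thus ?thesis
    unfolding cond_prob_subalg_def W.g2_tail_def[symmetric]
    by (intro W.cond_prob_not_tendsto_1_le[OF limit_event]) (auto simp: bandit_limit_def limI)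
qed

end

end

section \<open>From the one-sided estimate to the symmetric bound\<close>

text \<open>If \<open>y \<le> 1 / 2\<close>, then \<open>(1 - y) / y\<close> is at least 1 and the
  first minimum dominates \<open>r\<close>. Otherwise \<open>y / (1 - y)\<close> is at least 1 and
  dividing \<open>\<tau>\<close> by the smaller \<open>1 - y\<close> only enlarges it, so the second
  minimum does. The value of \<open>\<tau>\<close> may be infinite.\<close>

lemma le_max_min_ratio:
  fixes r y :: real and \<tau> :: ereal
  assumes y: "0 < y" "y < 1" and r: "r \<le> 1" "ereal r \<le> \<tau> / ereal y" and \<tau>: "0 \<le> \<tau>"
  shows "ereal r \<le> max (min (ereal ((1 - y) / y)) (\<tau> / ereal y))
            (min (ereal (y / (1 - y))) (\<tau> / ereal (1 - y)))"
proof (cases "y \<le> 1 / 2")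
  case True
  hence "1 \<le> (1 - y) / y" using y by (simp add: field_simps)
  hence "ereal r \<le> ereal ((1 - y) / y)" using r by simp
  with r show ?thesis by (simp add: le_max_iff_disj)
next
  case False
  hence "1 \<le> y / (1 - y)" using y by (simp add: field_simps)
  hence "ereal r \<le> ereal (y / (1 - y))" using r by simp
  moreover have "\<tau> / ereal y \<le> \<tau> / ereal (1 - y)"
    using False y \<tau> by (cases \<tau>) (auto intro!: divide_left_mono)
  ultimately show ?thesis using r by (simp add: le_max_iff_disj) (meson order_trans)
qed

theorem proposition9:
  fixes M :: "'a measure"
    and U :: "nat \<Rightarrow> 'a \<Rightarrow> real"
    and A B :: "nat \<Rightarrow> 'a set"
    and pA pB x :: real
    and \<gamma> :: "nat \<Rightarrow> real"
    and n :: nat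
  defines "X \<equiv> bandit U A B \<gamma> x"
    and "X_inf \<equiv> bandit_limit U A B \<gamma> x"
    and "x_inf \<equiv> (if pA > pB then 1 else 0 :: real)"
    and "tail \<equiv> (\<Sum>k. ereal ((\<gamma> (n + k + 1))\<^sup>2))"
  assumes "two_armed_bandit M U A B pA pB \<gamma>"
    and "pA \<noteq> pB"
    and "x \<in> {0<..<1}"
    and "n \<ge> 1"
  shows "AE \<omega> in M.
    ereal (cond_prob_subalg M (bandit_filtration M U A B n) (\<lambda>\<omega>'. X_inf \<omega>' \<noteq> x_inf) \<omega>)
      \<le> max (min (ereal ((1 - X n \<omega>) / X n \<omega>)) (tail / ereal (X n \<omega>)))
            (min (ereal (X n \<omega> / (1 - X n \<omega>))) (tail / ereal (1 - X n \<omega>)))"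
proof -
  interpret two_armed_bandit M U A B pA pB \<gamma> by fact
  note x = \<open>x \<in> {0<..<1}\<close>
  have X: "0 < X n \<omega>" "X n \<omega> < 1" for \<omega>
    using X_range[OF x, of n \<omega>] by (auto simp: X_def)
  have tail0: "0 \<le> tail" unfolding tail_def by (intro suminf_nonneg summable_ereal_pos) auto
  \<comment> \<open>With steps \<open>\<gamma> (Suc k)\<close>, the tail from index \<open>n\<close>
    begins with the square of \<open>\<gamma> (n + 1)\<close>, in agreement with
    \<open>g2_tail n\<close>.\<close>
  have tail_eq: "tail = ereal (\<Sum>j. (\<gamma> (Suc (j + n)))\<^sup>2)" if "summable (\<lambda>k. (\<gamma> (Suc k))\<^sup>2)"
  proof -
    have "summable (\<lambda>j. (\<gamma> (Suc (j + n)))\<^sup>2)"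
      using summable_ignore_initial_segment[OF that, of n] by simp
    hence "(\<lambda>j. ereal ((\<gamma> (Suc (j + n)))\<^sup>2)) sums ereal (\<Sum>j. (\<gamma> (Suc (j + n)))\<^sup>2)"
      by (simp add: sums_ereal summable_sums)
    from sums_unique[OF this] show ?thesis by (simp add: tail_def add.commute)
  qed
  have tail_inf: "tail = \<infinity>" if "\<not> summable (\<lambda>k. (\<gamma> (Suc k))\<^sup>2)"
  proof (rule ccontr)
    assume "tail \<noteq> \<infinity>"
    hence "summable (\<lambda>k. (\<gamma> (n + k + 1))\<^sup>2)"
      unfolding tail_def by (intro summable_ereal) auto
    hence "summable (\<lambda>k. (\<gamma> (Suc (k + n)))\<^sup>2)" by (simp add: add.commute)
    with that show False using summable_iff_shift[of "\<lambda>k. (\<gamma> (Suc k))\<^sup>2" n] by simp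
  qed
  let ?P = "cond_prob_subalg M (bandit_filtration M U A B n) (\<lambda>\<omega>'. X_inf \<omega>' \<noteq> x_inf)"
  have P1: "AE \<omega> in M. ?P \<omega> \<le> 1"
    unfolding X_inf_def by (rule cond_prob_limit_le_1[OF x])
  consider (inf) "\<not> summable (\<lambda>k. (\<gamma> (Suc k))\<^sup>2)"
    | (A) "pB < pA" "summable (\<lambda>k. (\<gamma> (Suc k))\<^sup>2)" | (B) "pA < pB" "summable (\<lambda>k. (\<gamma> (Suc k))\<^sup>2)"
    using \<open>pA \<noteq> pB\<close> by linarith
  thus ?thesis
  proof cases
    case inf
    show ?thesis using P1
    proof eventually_elim
      case (elim \<omega>)
      thus ?case using X[of \<omega>] tail_inf[OF inf] by (intro le_max_min_ratio) auto
    qed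
  next
    case A
    have "AE \<omega> in M. ?P \<omega> \<le> (\<Sum>j. (\<gamma> (Suc (j + n)))\<^sup>2) / X n \<omega>"
      using cond_prob_limit_ne_1_le[OF x A, of n] A by (simp add: X_inf_def X_def x_inf_def)
    with P1 show ?thesis
    proof eventually_elim
      case (elim \<omega>)
      thus ?case using X[of \<omega>] tail0 by (intro le_max_min_ratio) (auto simp: tail_eq[OF A(2)])
    qed
  next
    case B
    have "AE \<omega> in M. ?P \<omega> \<le> (\<Sum>j. (\<gamma> (Suc (j + n)))\<^sup>2) / (1 - X n \<omega>)"
      using cond_prob_limit_ne_0_le[OF x B, of n] B by (simp add: X_inf_def X_def x_inf_def)
    with P1 show ?thesis
    proof eventually_elim
      case (elim \<omega>)
      \<comment> \<open>Here \<open>le_max_min_ratio\<close> is used with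
        \<open>y = 1 - X n\<close>, which exchanges the two minima; the maximum is symmetric in
        them.\<close>
      hence "ereal (?P \<omega>) \<le> max (min (ereal ((1 - (1 - X n \<omega>)) / (1 - X n \<omega>))) (tail / ereal (1 - X n \<omega>)))
            (min (ereal ((1 - X n \<omega>) / (1 - (1 - X n \<omega>)))) (tail / ereal (1 - (1 - X n \<omega>))))"
        using X[of \<omega>] tail0 by (intro le_max_min_ratio) (auto simp: tail_eq[OF B(2)])
      thus ?case by (simp add: max.commute)
    qed
  qed
qed

end
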